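(* Consider three-pursuer one-evader games in $\mathbb{R}^2$ in which all players have unit speed and the initial evader position lies strictly inside the convex hull of the initial pursuer positions. Let $M_{\mathcal{D}}$ be the game length when the pursuers play the decentralized $\mathcal{D}$-strategy and the evader plays optimally against it, and let $M_{\mathcal{C}}$ be the optimal game length in the cooperative pursuers' setting (both defined in the context). Then there exist games such that $$M_{\mathcal{D}}=2M_{\mathcal{C}}.$$
   Context: **Game.** $E(t)\in\mathbb{R}^2$ and $P_i(t)\in\mathbb{R}^2$, $i=1,2,3$, are the evader and pursuer positions, with $\dot E(t)=e(t)$, $\dot P_i(t)=w_i(t)$, $\|e(t)\|=\|w_i(t)\|=1$; players can move in any direction in the whole plane. A game is specified by its initial condition $E(0),P_1(0),P_2(0),P_3(0)$. Capture occurs at the first time $t$ with $P_i(t)=E(t)$ for some $i$; the game length is the capture time. The evader knows the full state of the game. **Voronoi cell.** $\mathcal{V}(t)$ is the set of points of the plane closer to $E(t)$ than to every $P_i(t)$. Under the assumptions, $\mathcal{V}(0)$ is a triangle. Its vertices are named $V_1(0),V_2(0),V_3(0)$ so that $V_1(0)$ is the vertex joining the longest and the medium edges and $\|V_1(0)-V_2(0)\|$ is the length of the longest edge. **Decentralized length $M_{\mathcal{D}}$.** Let $\mathcal{L}(V,v)=\{V+\alpha v:\alpha\in\mathbb{R}\}$ and $v=V_1(0)-V_2(0)$. Put $S=\overline{V_2(0)V_3(0)}\cap\mathcal{L}(E(0),v)$, $Q=\overline{V_1(0)V_3(0)}\cap\mathcal{L}(E(0),v)$ and $M_{\mathcal{D}}=\|S-Q\|+\|Q-V_1(0)\|$.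 This is the length of the game when the evader plays optimally (surviving for the longest time) against the following decentralized pursuers' strategy ($\mathcal{D}$-strategy): with $C_i(t)=(P_i(t)+E(t))/2$, $z_i(t)=P_i(t)-E(t)$, $z_i(t)^\perp\neq0$ orthogonal to $z_i(t)$, and $B_i(t)=\mathcal{L}(E(t),e(t))\cap\mathcal{L}(C_i(t),z_i(t)^\perp)$, pursuer $i$ plays $w_i(t)=e(t)$ if $z_i(t)'e(t)\le0$ and $w_i(t)=(B_i(t)-P_i(t))/\|B_i(t)-P_i(t)\|$ if $z_i(t)'e(t)>0$ (the prime denotes transpose). **Cooperative length $M_{\mathcal{C}}$.** In a cooperative pursuers' strategy each pursuer knows the full game state and chooses $w_i(t)$ depending on $P_1(t),P_2(t),P_3(t),E(t)$ and $e(t)$. A pursuers' strategy is optimal when it guarantees capture in minimum time. $M_{\mathcal{C}}$ is the maximum capture time under the optimal cooperative pursuers' strategy, i.e. the time at which capture occurs if the evader plays at its best. **Limit convention.** When the evader is said to move to a point on the boundary of the Voronoi cell, it moves to an interior point of the cell at distance less than $\delta$ from it, for a small $\delta>0$; all results are understood as limit results obtained by letting $\delta$ tend to $0$.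
   Formalization: Equality M_D = 2 M_C holds for no single game, since M_D is at most the longest edge while 2 M_C strictly exceeds it; what is proved is a family of games, depending on δ, along which M_D tends to 2m and M_C tends to m, for some m > 0, as δ tends to 0. *)

theory Defs
  imports "HOL-Analysis.Analysis"
begin

type_synonym plane = "real ^ 2"

text \<open>
  The pursuers are indexed by the three-element type \<open>3\<close>. An initial condition is a pair
  \<open>E0 :: plane\<close>, \<open>P0 :: 3 \<Rightarrow> plane\<close>. A strategy maps the current pursuer positions, the current
  evader position and the current evader velocity to the velocity of each pursuer.
\<close>

type_synonym pursuer_strategy = "(3 \<Rightarrow> plane) \<Rightarrow> plane \<Rightarrow> plane \<Rightarrow> 3 \<Rightarrow> plane"

definition evader_inside :: "plane \<Rightarrow> (3 \<Rightarrow> plane) \<Rightarrow> bool" where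
  "evader_inside E0 P0 \<longleftrightarrow> E0 \<in> interior (convex hull (range P0))"

text \<open>
  Since the velocities have norm one, integrability over every \<open>{0..t}\<close> says exactly that they
  are Lebesgue measurable, and the integral equations below say that the trajectories are
  absolutely continuous with the prescribed derivatives almost everywhere. Plays are
  continued formally after capture; this has no influence on the capture time.
\<close>

definition evader_control :: "(real \<Rightarrow> plane) \<Rightarrow> bool" where
  "evader_control e \<longleftrightarrow> (\<forall>t\<ge>0. norm (e t) = 1 \<and> e integrable_on {0..t})"

definition is_play ::
  "pursuer_strategy \<Rightarrow> plane \<Rightarrow> (3 \<Rightarrow> plane) \<Rightarrow>
   (real \<Rightarrow> plane) \<Rightarrow> (real \<Rightarrow> plane) \<Rightarrow> (real \<Rightarrow> 3 \<Rightarrow> plane) \<Rightarrow> bool" where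
  "is_play \<sigma> E0 P0 e E P \<longleftrightarrow>
     evader_control e \<and>
     (\<forall>t\<ge>0. (e has_integral (E t - E0)) {0..t}) \<and>
     (\<forall>t\<ge>0. \<forall>i. ((\<lambda>s. \<sigma> (P s) (E s) (e s) i) has_integral (P t i - P0 i)) {0..t})"

text \<open>The value is \<open>\<infinity>\<close> if capture never occurs.\<close>

definition capture_time :: "(real \<Rightarrow> plane) \<Rightarrow> (real \<Rightarrow> 3 \<Rightarrow> plane) \<Rightarrow> ereal" where
  "capture_time E P = (INF t \<in> {t. 0 \<le> t \<and> (\<exists>i. P t i = E t)}. ereal t)"

text \<open>
  Length of the game when the evader plays at its best against \<open>\<sigma>\<close>. However the evader chooses
  its velocity (in particular by state feedback), the outcome is a play for the velocity it
  realizes, so the supremum is over all plays; it is a supremum because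
  the evader comes only arbitrarily close to boundary points of its Voronoi cell.
\<close>

definition game_length :: "pursuer_strategy \<Rightarrow> plane \<Rightarrow> (3 \<Rightarrow> plane) \<Rightarrow> ereal" where
  "game_length \<sigma> E0 P0 = (SUP (e, E, P) \<in> {(e, E, P). is_play \<sigma> E0 P0 e E P}. capture_time E P)"

text \<open>
  The closed-loop equations of a discontinuous feedback need not be solvable. Solvability
  against every evader control is required, since otherwise the supremum in
  \<open>game_length\<close> could range over too few plays, or none.
\<close>

definition admissible_strategy :: "plane \<Rightarrow> (3 \<Rightarrow> plane) \<Rightarrow> pursuer_strategy \<Rightarrow> bool" where
  "admissible_strategy E0 P0 \<sigma> \<longleftrightarrow>
     (\<forall>P E e i. norm e = 1 \<longrightarrow> norm (\<sigma> P E e i) = 1) \<and>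
     (\<forall>e. evader_control e \<longrightarrow> (\<exists>E P. is_play \<sigma> E0 P0 e E P))"

definition M_C :: "plane \<Rightarrow> (3 \<Rightarrow> plane) \<Rightarrow> ereal" where
  "M_C E0 P0 = (INF \<sigma> \<in> {\<sigma>. admissible_strategy E0 P0 \<sigma>}. game_length \<sigma> E0 P0)"

definition line_through :: "plane \<Rightarrow> plane \<Rightarrow> plane set" where
  "line_through V v = {V + \<alpha> *\<^sub>R v | \<alpha>. True}"

definition perp :: "plane \<Rightarrow> plane" where
  "perp z = vector [- (z $ 2), z $ 1]"

definition D_strategy :: pursuer_strategy where
  "D_strategy P E e i =
     (let z = P i - E;
          C = (1 / 2) *\<^sub>R (P i + E);
          B = (THE x. x \<in> line_through E e \<inter> line_through C (perp z))
      in if z \<bullet> e \<le> 0 then e else (1 / norm (B - P i)) *\<^sub>R (B - P i))"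

definition voronoi_cell :: "plane \<Rightarrow> (3 \<Rightarrow> plane) \<Rightarrow> plane set" where
  "voronoi_cell E P = {x. \<forall>i. dist x E < dist x (P i)}"

text \<open>
  \<open>V1 V2\<close> is the longest edge, \<open>V1 V3\<close> the medium one and \<open>V2 V3\<close> the shortest; ties are
  broken arbitrarily.
\<close>

definition voronoi_vertices :: "plane \<Rightarrow> (3 \<Rightarrow> plane) \<Rightarrow> plane \<Rightarrow> plane \<Rightarrow> plane \<Rightarrow> bool" where
  "voronoi_vertices E P V1 V2 V3 \<longleftrightarrow>
     \<not> collinear {V1, V2, V3} \<and>
     closure (voronoi_cell E P) = convex hull {V1, V2, V3} \<and>
     dist V2 V3 \<le> dist V1 V3 \<and> dist V1 V3 \<le> dist V1 V2"

text \<open>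
  In case of ties all admissible namings of the vertices give the same length.
\<close>

definition M_D :: "plane \<Rightarrow> (3 \<Rightarrow> plane) \<Rightarrow> real" where
  "M_D E0 P0 = (THE l. \<exists>V1 V2 V3 S Q.
     voronoi_vertices E0 P0 V1 V2 V3 \<and>
     closed_segment V2 V3 \<inter> line_through E0 (V1 - V2) = {S} \<and>
     closed_segment V1 V3 \<inter> line_through E0 (V1 - V2) = {Q} \<and>
     l = norm (S - Q) + norm (Q - V1))"

end

theory Submission
  imports Defs
begin

text \<open>
  Under the decentralized strategy the direction of \<open>z\<^sub>i = P\<^sub>i - E\<close> never changes, and the evader
  survives exactly as long as \<open>\<integral> max 0 (z\<^sub>i(0) \<bullet> e) < |z\<^sub>i(0)|\<^sup>2 / 2\<close> for all \<open>i\<close>. Only the time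
  spent in each direction matters, so the length of the game is the value of a linear program.

  Take a flat isosceles Voronoi triangle with base from \<open>-1\<close> to \<open>1\<close> and height \<open>k\<close>, the evader being
  near the midpoint of the base. Against the decentralized strategy the evader can run almost to
  the left end and then almost the same length back to the right, in total almost \<open>2\<close>. All pursuers
  are at distance \<open>O(k)\<close>, so cooperating pursuers can use a run of length \<open>O(k)\<close> to one side to place
  a pursuer behind the evader. Then only the run to one end, of length about \<open>1\<close>, is left.
\<close>

section \<open>Indefinite integrals and parallel approach\<close>

text \<open>The factor 2 appears as a limit along a family of triangles: the length against the
  decentralized strategy is \<open>2 * (1 - k) + k * sqrt (1 + k^2)\<close>, the cooperative length
  lies between \<open>1 - k\<close> and \<open>1 + 14 * k\<close>, and at \<open>k = 0\<close> the
  triangle degenerates to a segment. The evader has to lie strictly above the base; the distance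
  \<open>k^2\<close> is chosen of smaller order than the height \<open>k\<close>, so that its level
  line still has half-length \<open>1 - k\<close> and a descent can gain it only
  \<open>O(k)\<close>. The obstacle is that both pursuit laws are discontinuous feedbacks.
  Solvability against every measurable control has to be proved, and no uniqueness of plays is at
  hand. Upper bounds are therefore derived for arbitrary plays, from sign conditions on rates of
  change. Existence rests on explicit solutions: relative motion along a fixed ray and, for the
  cooperative strategy, a single change of mode.\<close>

definition primitive_on :: "(real \<Rightarrow> 'a::banach) \<Rightarrow> (real \<Rightarrow> 'a) \<Rightarrow> real \<Rightarrow> real \<Rightarrow> bool" where
  "primitive_on f F a b \<longleftrightarrow> (\<forall>t\<in>{a..b}. (f has_integral (F t - F a)) {a..t})"

lemma primitive_onD:
  "primitive_on f F a b \<Longrightarrow> a \<le> t \<Longrightarrow> t \<le> b \<Longrightarrow> (f has_integral (F t - F a)) {a..t}"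
  by (auto simp: primitive_on_def)

lemma primitive_on_integral:
  assumes "f integrable_on {a..b}"
  shows "primitive_on f (\<lambda>t. integral {a..t} f) a b"
  unfolding primitive_on_def
proof
  fix t assume "t \<in> {a..b}"
  then have "f integrable_on {a..t}"
    by (intro integrable_on_subinterval[OF assms]) auto
  then show "(f has_integral integral {a..t} f - integral {a..a} f) {a..t}"
    by (simp add: has_integral_integral)
qed

lemma primitive_on_subinterval:
  assumes "primitive_on f F a b" "a \<le> s" "t \<le> b"
  shows "primitive_on f F s t"
  unfolding primitive_on_def
proof
  fix u assume "u \<in> {s..t}"
  then have u: "s \<le> u" "u \<le> t" by auto
  have i1: "(f has_integral (F s - F a)) {a..s}" and i2: "(f has_integral (F u - F a)) {a..u}"
    using primitive_onD[OF assms(1)] assms u by auto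
  have "f integrable_on {s..u}"
    by (rule integrable_on_subinterval[of f "{a..u}"]) (use i2 assms(2) in auto)
  then obtain j where j: "(f has_integral j) {s..u}" by blast
  have "F s - F a + j = F u - F a"
    using has_integral_combine[OF assms(2) u(1) i1 j] i2 has_integral_unique by blast
  then have "j = F u - F s" by (simp add: algebra_simps)
  with j show "(f has_integral (F u - F s)) {s..u}" by simp
qed

lemma primitive_on_continuous:
  assumes "primitive_on f F a b"
  shows "continuous_on {a..b} F"
proof (cases "a \<le> b")
  case True
  have "f integrable_on {a..b}" using primitive_onD[OF assms True] by auto
  then have "continuous_on {a..b} (\<lambda>t. F a + integral {a..t} f)"
    by (intro continuous_intros indefinite_integral_continuous_1)
  moreover have "F a + integral {a..t} f = F t" if "t \<in> {a..b}" for t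
    using primitive_onD[OF assms, of t] that by (auto simp: integral_unique)
  ultimately show ?thesis by (rule continuous_on_eq)
qed simp

lemma primitive_on_join:
  assumes "primitive_on f F a b" "primitive_on f F b c" "a \<le> b"
  shows "primitive_on f F a c"
  unfolding primitive_on_def
proof
  fix t assume t: "t \<in> {a..c}"
  show "(f has_integral (F t - F a)) {a..t}"
  proof (cases "t \<le> b")
    case True then show ?thesis using t primitive_onD[OF assms(1)] by auto
  next
    case False
    have "(f has_integral (F b - F a) + (F t - F b)) {a..t}"
      using False t assms by (intro has_integral_combine[of a b t] primitive_onD) auto
    then show ?thesis by simp
  qed
qed

text \<open>The integrands need not agree at \<open>b\<close>: at a switching time the feedback
  already takes its new value, and one point does not affect the integral.\<close>

lemma primitive_on_cong:
  assumes "primitive_on f F a b" and "\<And>t. a \<le> t \<Longrightarrow> t \<le> b \<Longrightarrow> F t = G t"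
    and "\<And>t. a \<le> t \<Longrightarrow> t < b \<Longrightarrow> f t = g t"
  shows "primitive_on g G a b"
  unfolding primitive_on_def
proof
  fix t assume t: "t \<in> {a..b}"
  have "(g has_integral (F t - F a)) {a..t}"
    using t assms(3) by (intro has_integral_spike_finite[of "{b}" _ g f] primitive_onD[OF assms(1)]) auto
  then show "(g has_integral (G t - G a)) {a..t}" using assms(2)[of t] assms(2)[of a] t by auto
qed

lemma primitive_on_linear:
  assumes "primitive_on f F a b" "bounded_linear h"
  shows "primitive_on (\<lambda>t. h (f t)) (\<lambda>t. h (F t)) a b"
  using assms has_integral_linear[OF primitive_onD[OF assms(1)] assms(2)]
  by (auto simp: primitive_on_def o_def linear_diff bounded_linear.linear)

lemma primitive_on_add:
  assumes "primitive_on f F a b" "primitive_on g G a b"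
  shows "primitive_on (\<lambda>t. f t + g t) (\<lambda>t. F t + G t) a b"
  using assms has_integral_add[OF primitive_onD[OF assms(1)] primitive_onD[OF assms(2)]]
  unfolding primitive_on_def by (auto simp: algebra_simps)

lemma primitive_on_diff:
  assumes "primitive_on f F a b" "primitive_on g G a b"
  shows "primitive_on (\<lambda>t. f t - g t) (\<lambda>t. F t - G t) a b"
  using assms has_integral_diff[OF primitive_onD[OF assms(1)] primitive_onD[OF assms(2)]]
  unfolding primitive_on_def by (auto simp: algebra_simps)

lemma primitive_on_unique:
  assumes "primitive_on f F a b" "primitive_on f G a b" "F a = G a" "a \<le> t" "t \<le> b"
  shows "F t = G t"
  using has_integral_unique[OF primitive_onD[OF assms(1)] primitive_onD[OF assms(2)]] assms by simp

section \<open>Crossing times and one-dimensional comparison principles\<close>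

lemma first_zero:
  fixes F :: "real \<Rightarrow> real"
  assumes cont: "continuous_on {a..b} F" and F: "F a < 0" "0 \<le> F b" and ab: "a \<le> b"
  obtains \<tau> where "a \<le> \<tau>" "\<tau> \<le> b" "F \<tau> = 0" "\<And>t. a \<le> t \<Longrightarrow> t < \<tau> \<Longrightarrow> F t < 0"
proof -
  define S where "S = {t \<in> {a..b}. 0 \<le> F t}"
  have "closed S" unfolding S_def by (intro continuous_on_closed_Collect_le cont continuous_intros)
  moreover have "bounded S" unfolding S_def by (rule bounded_subset[of "{a..b}"]) auto
  ultimately have "compact S" by (simp add: compact_eq_bounded_closed)
  moreover have "b \<in> S" using F ab by (simp add: S_def)
  ultimately obtain \<tau> where \<tau>: "\<tau> \<in> S" and min: "\<And>t. t \<in> S \<Longrightarrow> \<tau> \<le> t"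
    using compact_attains_inf[of S] by blast
  have ab\<tau>: "a \<le> \<tau>" "\<tau> \<le> b" "0 \<le> F \<tau>" using \<tau> by (auto simp: S_def)
  have neg: "F t < 0" if "a \<le> t" "t < \<tau>" for t
    using min[of t] that ab\<tau> by (force simp: S_def)
  have "continuous_on {a..\<tau>} F" using ab\<tau> by (auto intro: continuous_on_subset[OF cont])
  then obtain s where s: "a \<le> s" "s \<le> \<tau>" "F s = 0"
    using IVT'[of F a 0 \<tau>] F ab\<tau> by auto
  then have "s = \<tau>" using neg[of s] by force
  then show ?thesis using that ab\<tau> neg s by blast
qed

text \<open>After the last time at which \<open>F\<close> is nonpositive it would stay positive, and
  there it can only decrease.\<close>

lemma primitive_on_nonpos:
  fixes F :: "real \<Rightarrow> real"
  assumes F: "primitive_on f F a b" and "F a \<le> 0" and t: "a \<le> t" "t \<le> b"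
    and down: "\<And>s. a \<le> s \<Longrightarrow> s \<le> b \<Longrightarrow> 0 < F s \<Longrightarrow> f s \<le> 0"
  shows "F t \<le> 0"
proof (rule ccontr)
  assume "\<not> F t \<le> 0"
  define S where "S = {s \<in> {a..t}. F s \<le> 0}"
  have c: "continuous_on {a..t} F"
    using primitive_on_continuous[OF F] t by (auto intro: continuous_on_subset)
  have "compact S"
  proof -
    have "closed S" unfolding S_def
      by (intro continuous_on_closed_Collect_le c continuous_intros)
    moreover have "bounded S" unfolding S_def by (rule bounded_subset[of "{a..t}"]) auto
    ultimately show ?thesis by (simp add: compact_eq_bounded_closed)
  qed
  moreover have "a \<in> S" using assms by (auto simp: S_def)
  ultimately obtain s where s: "s \<in> S" and max: "\<And>u. u \<in> S \<Longrightarrow> u \<le> s"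
    using compact_attains_sup[of S] by blast
  have st: "a \<le> s" "s \<le> t" "F s \<le> 0" using s by (auto simp: S_def)
  have pos: "0 < F u" if "s < u" "u \<le> t" for u
    using max[of u] that st by (force simp: S_def)
  have "primitive_on f F s t" using primitive_on_subinterval[OF F] st t by auto
  then have "(f has_integral (F t - F s)) {s..t}" using st by (auto dest: primitive_onD)
  \<comment> \<open>At \<open>s\<close> itself \<open>F\<close> is not positive, so the sign of
    \<open>f s\<close> is unknown; the integrand is altered at this point.\<close>
  then have spike: "((\<lambda>u. if u = s then 0 else f u) has_integral (F t - F s)) {s..t}"
    by (rule has_integral_spike_finite[of "{s}", rotated 2]) auto
  have "F t - F s \<le> 0"
    by (rule has_integral_le[OF spike, of "\<lambda>_. 0"]) (use st t down pos in auto)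
  with \<open>\<not> F t \<le> 0\<close> st show False by auto
qed

text \<open>A rate that never points away from \<open>0\<close> cannot move a quantity off
  \<open>0\<close>. This takes the place of a uniqueness theorem for the discontinuous
  equations.\<close>

lemma primitive_on_zero:
  fixes F :: "real \<Rightarrow> real"
  assumes F: "primitive_on f F a b" and "F a = 0" and t: "a \<le> t" "t \<le> b"
    and down: "\<And>s. a \<le> s \<Longrightarrow> s \<le> b \<Longrightarrow> f s * F s \<le> 0"
  shows "F t = 0"
proof -
  have "F t \<le> 0"
  proof (rule primitive_on_nonpos[OF F _ t])
    fix s assume "a \<le> s" "s \<le> b" "0 < F s"
    then show "f s \<le> 0" using down[of s] by (simp add: mult_le_0_iff)
  qed (use assms in simp)
  moreover have "primitive_on (\<lambda>t. - f t) (\<lambda>t. - F t) a b"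
    using primitive_on_linear[OF F bounded_linear_minus[OF bounded_linear_ident]] by simp
  then have "- F t \<le> 0"
  proof (rule primitive_on_nonpos[OF _ _ t])
    fix s assume "a \<le> s" "s \<le> b" "0 < - F s"
    then show "- f s \<le> 0" using down[of s] by (simp add: mult_le_0_iff)
  qed (use assms in simp)
  ultimately show ?thesis by simp
qed

section \<open>Position of a pursuer relative to the evader\<close>

lemma integrable_pos_part_inner:
  fixes e :: "real \<Rightarrow> 'a::euclidean_space"
  assumes "e integrable_on {a..b}" "\<And>t. t \<in> {a..b} \<Longrightarrow> norm (e t) = 1"
  shows "(\<lambda>t. max 0 (n \<bullet> e t)) integrable_on {a..b}"
proof -
  have "e absolutely_integrable_on {a..b}"
    by (rule absolutely_integrable_integrable_bound[of _ _ "\<lambda>_. 1"]) (use assms in auto)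
  then have "(\<lambda>t. n \<bullet> e t) absolutely_integrable_on {a..b}"
    using absolutely_integrable_linear[OF _ bounded_linear_inner_right[of n]] by (simp add: o_def)
  then have "(\<lambda>t. max 0 (n \<bullet> e t)) absolutely_integrable_on {a..b}"
    by (intro absolutely_integrable_max_1) auto
  then show ?thesis by (rule set_lebesgue_integral_eq_integral)
qed

text \<open>The rate of change of \<open>z = P - E\<close> under the decentralized strategy, which turns out to
  reflect \<open>e\<close> in the bisector of \<open>P\<close> and \<open>E\<close> when \<open>z \<bullet> e > 0\<close>. It is \<open>0\<close> for \<open>z = 0\<close>.\<close>

definition approach :: "'a::euclidean_space \<Rightarrow> 'a \<Rightarrow> 'a" where
  "approach z e = (- 2 * max 0 (z \<bullet> e) / (z \<bullet> z)) *\<^sub>R z"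

lemma approach_zero [simp]: "approach 0 e = 0"
  by (simp add: approach_def)

lemma norm_approach: "norm e = 1 \<Longrightarrow> norm (e + approach z e) = 1"
proof -
  assume e: "norm e = 1"
  show ?thesis
  proof (cases "z = 0 \<or> z \<bullet> e \<le> 0")
    case True then show ?thesis using e by (auto simp: approach_def max_def)
  next
    case False
    then have "(e + approach z e) \<bullet> (e + approach z e) = e \<bullet> e"
      by (simp add: approach_def inner_diff inner_commute field_simps power2_eq_square)
    then show ?thesis using e by (simp add: norm_eq_sqrt_inner)
  qed
qed

text \<open>The rate is a nonpositive multiple of \<open>z\<close>, so components orthogonal to
  \<open>z a\<close> stay \<open>0\<close>, and since \<open>z\<close> does not vanish its
  coefficient along \<open>z a\<close> stays positive. By positive homogeneity the length of
  \<open>z\<close> then cancels, and the evader consumes a budget of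
  \<open>z a \<bullet> z a / 2\<close> at the rate \<open>max 0 (z a \<bullet> e t)\<close>. The
  argument applies to every solution, hence to every play.\<close>

lemma approach_ray:
  fixes z :: "real \<Rightarrow> 'a::euclidean_space"
  assumes z: "primitive_on (\<lambda>t. approach (z t) (e t)) z a b" and "a \<le> b"
    and nz: "\<And>t. a \<le> t \<Longrightarrow> t \<le> b \<Longrightarrow> z t \<noteq> 0"
  shows "((\<lambda>t. max 0 (z a \<bullet> e t)) has_integral (z a \<bullet> z a - z a \<bullet> z b) / 2) {a..b}"
    and "z a \<bullet> z b > 0"
proof -
  define n where "n = z a"
  have n: "n \<noteq> 0" using nz[of a] assms by (simp add: n_def)
  then have nn: "n \<bullet> n > 0" by simp
  define q where "q t = (z t \<bullet> n) / (n \<bullet> n)" for t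
  have comp: "z t \<bullet> p = 0" if "n \<bullet> p = 0" "a \<le> t" "t \<le> b" for t p
  proof -
    have P: "primitive_on (\<lambda>t. approach (z t) (e t) \<bullet> p) (\<lambda>t. z t \<bullet> p) a b"
      by (rule primitive_on_linear[OF z bounded_linear_inner_left])
    show ?thesis
      by (rule primitive_on_zero[OF P _ that(2,3)])
        (use that in \<open>auto simp: n_def approach_def mult.assoc intro!: divide_nonneg_nonneg mult_nonneg_nonneg\<close>)
  qed
  have zq: "z t = q t *\<^sub>R n" if "a \<le> t" "t \<le> b" for t
  proof -
    define p where "p = z t - q t *\<^sub>R n"
    have np: "n \<bullet> p = 0" using n by (simp add: p_def q_def inner_diff_right inner_commute)
    then have "z t \<bullet> p = 0" using comp that by blast
    then have "p \<bullet> p = 0" using np by (simp add: p_def inner_diff_left inner_diff_right inner_commute)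
    then show ?thesis by (simp add: p_def)
  qed
  have qa: "q a = 1" using n by (simp add: q_def n_def)
  have q0: "q t \<noteq> 0" if "a \<le> t" "t \<le> b" for t
    using zq[OF that] nz[OF that] by auto
  have Q: "primitive_on (\<lambda>t. (approach (z t) (e t) \<bullet> n) / (n \<bullet> n)) q a b"
    unfolding q_def
    by (rule primitive_on_linear[OF z, of "\<lambda>x. (x \<bullet> n) / (n \<bullet> n)"])
      (intro bounded_linear_divide[THEN bounded_linear_compose] bounded_linear_inner_left)
  have qpos: "q t > 0" if t: "a \<le> t" "t \<le> b" for t
  proof (rule ccontr)
    assume "\<not> q t > 0"
    then have "q t \<le> 0" by simp
    moreover have "continuous_on {a..t} q"
      using primitive_on_continuous[OF Q] t by (auto intro: continuous_on_subset)
    ultimately obtain s where "a \<le> s" "s \<le> t" "q s = 0"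
      using IVT2'[of q t 0 a] qa t by auto
    then show False using q0 t by auto
  qed
  have "((\<lambda>t. (approach (z t) (e t) \<bullet> n) / (n \<bullet> n)) has_integral (q b - q a)) {a..b}"
    using primitive_onD[OF Q] assms by simp
  then have "((\<lambda>t. ((approach (z t) (e t) \<bullet> n) / (n \<bullet> n)) * (- (n \<bullet> n) / 2)) has_integral
      (q b - q a) * (- (n \<bullet> n) / 2)) {a..b}"
    by (rule has_integral_mult_left)
  moreover have "((approach (z t) (e t) \<bullet> n) / (n \<bullet> n)) * (- (n \<bullet> n) / 2) = max 0 (n \<bullet> e t)"
    if "t \<in> {a..b}" for t
  proof -
    have "max 0 (q t * (n \<bullet> e t)) = q t * max 0 (n \<bullet> e t)"
      using qpos[of t] that by (auto simp: max_def zero_le_mult_iff mult_le_0_iff)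
    then show ?thesis using qpos[of t] that n by (auto simp: approach_def zq field_simps)
  qed
  ultimately have "((\<lambda>t. max 0 (n \<bullet> e t)) has_integral (q b - q a) * (- (n \<bullet> n) / 2)) {a..b}"
    by (rule has_integral_eq[rotated])
  moreover have "(q b - q a) * (- (n \<bullet> n) / 2) = (n \<bullet> n - n \<bullet> z b) / 2"
    unfolding qa using n by (simp add: q_def field_simps inner_commute)
  ultimately show "((\<lambda>t. max 0 (z a \<bullet> e t)) has_integral (z a \<bullet> z a - z a \<bullet> z b) / 2) {a..b}"
    unfolding n_def by metis
  show "z a \<bullet> z b > 0"
    using qpos[of b] assms nn unfolding n_def q_def
    by (simp add: inner_commute zero_less_divide_iff)
qed

text \<open>The solution is explicit: \<open>z0\<close> shrinks in proportion to the consumed budget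
  and rests at \<open>0\<close> afterwards, which is consistent because
  \<open>approach 0 e = 0\<close>.\<close>

lemma approach_exists:
  fixes e :: "real \<Rightarrow> 'a::euclidean_space" and z0 :: 'a
  assumes e: "\<And>t. t \<ge> a \<Longrightarrow> e integrable_on {a..t}" "\<And>t. t \<ge> a \<Longrightarrow> norm (e t) = 1"
  obtains z where "z a = z0" "\<And>b. primitive_on (\<lambda>t. approach (z t) (e t)) z a b"
    "\<And>t. a \<le> t \<Longrightarrow> integral {a..t} (\<lambda>t. max 0 (z0 \<bullet> e t)) < z0 \<bullet> z0 / 2 \<Longrightarrow> z t \<noteq> 0"
proof (cases "z0 = 0")
  case True
  have "primitive_on (\<lambda>t. approach (0::'a) (e t)) (\<lambda>_. 0) a b" for b
    by (simp add: primitive_on_def)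
  moreover have "\<not> integral {a..t} (\<lambda>t. max 0 (z0 \<bullet> e t)) < z0 \<bullet> z0 / 2" for t
    using True by simp
  ultimately show ?thesis using that[of "\<lambda>_. 0"] True by blast
next
  case False
  \<comment> \<open>The rate of consumption as a fraction of the budget
    \<open>z0 \<bullet> z0 / 2\<close>; capture happens when its integral \<open>G\<close> reaches
    \<open>1\<close>.\<close>
  define g where "g t = 2 * max 0 (z0 \<bullet> e t) / (z0 \<bullet> z0)" for t
  have gi: "g integrable_on {a..t}" if "t \<ge> a" for t
  proof -
    have "(\<lambda>s. max 0 (z0 \<bullet> e s)) integrable_on {a..t}"
      using e that by (intro integrable_pos_part_inner) auto
    from integrable_on_cmult_left[OF this, of "2 / (z0 \<bullet> z0)"] show ?thesis
      by (simp add: g_def[abs_def])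
  qed
  have g0: "g t \<ge> 0" for t using False by (simp add: g_def)
  define G where "G t = integral {a..t} g" for t
  define r where "r t = max 0 (1 - G t)" for t
  define z where "z t = r t *\<^sub>R z0" for t
  have PG: "primitive_on g G a b" for b
  proof (cases "a \<le> b")
    case True then show ?thesis unfolding G_def by (intro primitive_on_integral gi)
  qed (simp add: primitive_on_def)
  have Ga: "G a = 0" by (simp add: G_def)
  have mono: "G s \<le> G t" if "a \<le> s" "s \<le> t" for s t
    unfolding G_def by (intro integral_subset_le gi) (use that g0 in auto)
  have run: "approach (z t) (e t) = - (g t *\<^sub>R z0)" if "G t < 1" for t
  proof -
    have "r t > 0" using that by (simp add: r_def)
    then have "max 0 (r t * (z0 \<bullet> e t)) = r t * max 0 (z0 \<bullet> e t)"
      by (auto simp: max_def zero_le_mult_iff mult_le_0_iff)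
    then show ?thesis using \<open>r t > 0\<close> False by (simp add: approach_def z_def g_def)
  qed
  have stop: "z t = 0" if "G t \<ge> 1" for t
    using that by (simp add: z_def r_def)
  have zG: "(1 - G t) *\<^sub>R z0 = z t" if "G t \<le> 1" for t
    using that by (simp add: z_def r_def)
  have P1: "primitive_on (\<lambda>t. - (g t *\<^sub>R z0)) (\<lambda>t. (1 - G t) *\<^sub>R z0) a b" for b
    unfolding primitive_on_def
  proof
    fix t assume "t \<in> {a..b}"
    then have "(g has_integral (G t - G a)) {a..t}" using primitive_onD[OF PG] by auto
    then have "((\<lambda>t. - (g t *\<^sub>R z0)) has_integral - ((G t - G a) *\<^sub>R z0)) {a..t}"
      by (intro has_integral_neg has_integral_scaleR_left)
    moreover have "- ((G t - G a) *\<^sub>R z0) = (1 - G t) *\<^sub>R z0 - (1 - G a) *\<^sub>R z0"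
      by (simp add: scaleR_left_diff_distrib)
    ultimately show "((\<lambda>t. - (g t *\<^sub>R z0)) has_integral
        (1 - G t) *\<^sub>R z0 - (1 - G a) *\<^sub>R z0) {a..t}"
      by metis
  qed
  have prim: "primitive_on (\<lambda>t. approach (z t) (e t)) z a b" for b
  proof (cases "\<exists>t\<ge>a. G t \<ge> 1")
    case no_hit: False
    show ?thesis
    proof (rule primitive_on_cong[OF P1])
      fix t assume "a \<le> t"
      with no_hit have "G t < 1" by (meson not_le)
      then show "(1 - G t) *\<^sub>R z0 = z t" "- (g t *\<^sub>R z0) = approach (z t) (e t)"
        using zG run by auto
    qed
  next
    case True
    then obtain t1 where t1: "a \<le> t1" "1 \<le> G t1" by blast
    have "continuous_on {a..t1} (\<lambda>t. G t - 1)"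
      by (intro continuous_intros primitive_on_continuous[OF PG])
    then obtain \<rho> where \<rho>: "a \<le> \<rho>" "G \<rho> = 1" and lt: "\<And>t. a \<le> t \<Longrightarrow> t < \<rho> \<Longrightarrow> G t < 1"
      by (rule first_zero) (use t1 Ga in auto)
    have before: "primitive_on (\<lambda>t. approach (z t) (e t)) z a \<rho>"
    proof (rule primitive_on_cong[OF P1])
      fix t assume t: "a \<le> t"
      show "(1 - G t) *\<^sub>R z0 = z t" if "t \<le> \<rho>"
        using zG[of t] lt[of t] t that \<rho> by (cases "t = \<rho>") auto
      show "- (g t *\<^sub>R z0) = approach (z t) (e t)" if "t < \<rho>"
        using run[of t] lt[of t] t that by simp
    qed
    have zero: "z t = 0" if "t \<ge> \<rho>" for t
      using stop[of t] mono[of \<rho> t] that \<rho> by auto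
    have "primitive_on (\<lambda>t. approach (z t) (e t)) z \<rho> b"
      unfolding primitive_on_def
    proof
      fix t assume t: "t \<in> {\<rho>..b}"
      have "((\<lambda>t. approach (z t) (e t)) has_integral 0) {\<rho>..t}"
        by (rule has_integral_is_0) (simp add: zero)
      then show "((\<lambda>t. approach (z t) (e t)) has_integral (z t - z \<rho>)) {\<rho>..t}"
        using t zero[of t] zero[of \<rho>] by simp
    qed
    then show ?thesis using \<rho> by (intro primitive_on_join[OF before]) auto
  qed
  have "z t \<noteq> 0" if "a \<le> t" "integral {a..t} (\<lambda>t. max 0 (z0 \<bullet> e t)) < z0 \<bullet> z0 / 2" for t
  proof -
    have "g = (\<lambda>t. 2 / (z0 \<bullet> z0) * max 0 (z0 \<bullet> e t))"
      by (simp add: g_def[abs_def])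
    then have "G t = 2 / (z0 \<bullet> z0) * integral {a..t} (\<lambda>t. max 0 (z0 \<bullet> e t))"
      unfolding G_def by (simp only: integral_mult_right)
    also have "\<dots> < 2 / (z0 \<bullet> z0) * (z0 \<bullet> z0 / 2)"
      using that(2) False by (intro mult_strict_left_mono) auto
    also have "\<dots> = 1" using False by simp
    finally show ?thesis using False by (simp add: z_def r_def)
  qed
  moreover have "z a = z0" using Ga by (simp add: z_def r_def)
  ultimately show ?thesis using prim that[of z] by metis
qed

section \<open>Thin isosceles Voronoi cells\<close>

definition pt :: "real \<Rightarrow> real \<Rightarrow> plane" where
  "pt a b = vector [a, b]"

lemma pt_component [simp]: "pt a b $ 1 = a" "pt a b $ 2 = b"
  by (simp_all add: pt_def)

lemma pt_eq_iff: "x = y \<longleftrightarrow> x $ 1 = y $ 1 \<and> x $ 2 = y $ 2" for x y :: plane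
  by (simp add: vec_eq_iff forall_2)

lemma inner_plane: "x \<bullet> y = x $ 1 * y $ 1 + x $ 2 * y $ 2" for x y :: plane
  by (simp add: inner_vec_def sum_2)

lemma norm_plane: "norm x = sqrt ((x $ 1)\<^sup>2 + (x $ 2)\<^sup>2)" for x :: plane
  by (simp add: norm_eq_sqrt_inner inner_plane power2_eq_square)

lemma collinear_plane:
  fixes a b c :: plane
  assumes "collinear {a, b, c}"
  shows "(b - a) $ 1 * (c - a) $ 2 = (b - a) $ 2 * (c - a) $ 1"
proof -
  obtain u where u: "\<And>x y. x \<in> {a, b, c} \<Longrightarrow> y \<in> {a, b, c} \<Longrightarrow> \<exists>r. x - y = r *\<^sub>R u"
    using assms unfolding collinear_def by metis
  obtain r s where "b - a = r *\<^sub>R u" "c - a = s *\<^sub>R u"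
    using u[of b a] u[of c a] by auto
  then show ?thesis by simp
qed

text \<open>Reflecting the origin in the side \<open>x $ 2 - k * x $ 1 = k - k^2\<close> gives
  \<open>offset k\<close> times the normal vector \<open>(- k, 1)\<close>, and symmetrically for the
  other side; this is the common height of the two upper pursuers.\<close>

definition offset :: "real \<Rightarrow> real" where
  "offset k = 2 * (k - k\<^sup>2) / (1 + k\<^sup>2)"

text \<open>The reflections of the origin in the sides of the triangle with vertices
  \<open>(\<plusminus>1, - k\<^sup>2)\<close> and \<open>(0, k - k\<^sup>2)\<close>, so that this triangle is the Voronoi cell. The distance
  \<open>k\<^sup>2\<close> to the base is negligible compared with the height \<open>k\<close>.\<close>

definition start :: "real \<Rightarrow> 3 \<Rightarrow> plane" where
  "start k i = (if i = 1 then pt 0 (- 2 * k\<^sup>2)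
     else if i = 2 then pt (- k * offset k) (offset k) else pt (k * offset k) (offset k))"

lemma start_simps [simp]:
  "start k 1 = pt 0 (- 2 * k\<^sup>2)"
  "start k 2 = pt (- k * offset k) (offset k)"
  "start k 3 = pt (k * offset k) (offset k)"
  by (simp_all add: start_def)

lemma offset_bounds:
  assumes "0 < k" "k < 1"
  shows "0 < offset k" "offset k \<le> 2 * k" "(1 + k\<^sup>2) * offset k = 2 * (k - k\<^sup>2)"
proof -
  have "k\<^sup>2 < k" using assms by (simp add: power2_eq_square)
  moreover have p: "1 + k\<^sup>2 > 0" by (simp add: add_pos_nonneg)
  ultimately show "0 < offset k" by (simp add: offset_def)
  show m: "(1 + k\<^sup>2) * offset k = 2 * (k - k\<^sup>2)" using p by (simp add: offset_def)
  have "2 * (k - k\<^sup>2) \<le> 2 * k * (1 + k\<^sup>2)"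
    using assms by (simp add: algebra_simps add_nonneg_nonneg)
  then show "offset k \<le> 2 * k" using p by (simp add: offset_def divide_le_eq)
qed

lemma start_inner_self:
  assumes "0 < k" "k < 1"
  shows "start k 1 \<bullet> start k 1 / 2 = 2 * k ^ 4"
    "start k 2 \<bullet> start k 2 / 2 = offset k * (k - k\<^sup>2)"
    "start k 3 \<bullet> start k 3 / 2 = offset k * (k - k\<^sup>2)"
proof -
  show "start k 1 \<bullet> start k 1 / 2 = 2 * k ^ 4"
    by (simp add: inner_plane power2_eq_square power4_eq_xxxx)
  have "start k 2 \<bullet> start k 2 = offset k * ((1 + k\<^sup>2) * offset k)"
      "start k 3 \<bullet> start k 3 = offset k * ((1 + k\<^sup>2) * offset k)"
    by (simp_all add: inner_plane power2_eq_square algebra_simps)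
  then show "start k 2 \<bullet> start k 2 / 2 = offset k * (k - k\<^sup>2)"
      "start k 3 \<bullet> start k 3 / 2 = offset k * (k - k\<^sup>2)"
    unfolding offset_bounds(3)[OF assms] by simp_all
qed

lemma evader_inside_start:
  assumes "0 < k" "k < 1"
  shows "evader_inside 0 (start k)"
proof -
  note o = offset_bounds[OF assms]
  define a b c where "a = start k 1" and "b = start k 2" and "c = start k 3"
  have "\<not> collinear {a, b, c}"
  proof
    assume "collinear {a, b, c}"
    from collinear_plane[OF this] have "(offset k + 2 * k\<^sup>2) * (k * offset k) = 0"
      by (simp add: a_def b_def c_def algebra_simps)
    then show False using o assms by (simp add: add_nonneg_eq_0_iff)
  qed
  then have "interior (convex hull {a, b, c}) =
      {v. \<exists>x y z. 0 < x \<and> 0 < y \<and> 0 < z \<and> x + y + z = 1 \<and> x *\<^sub>R a + y *\<^sub>R b + z *\<^sub>R c = v}"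
    by (rule interior_convex_hull_3_minimal) simp
  moreover have "\<exists>x y z. 0 < x \<and> 0 < y \<and> 0 < z \<and> x + y + z = 1 \<and> x *\<^sub>R a + y *\<^sub>R b + z *\<^sub>R c = 0"
  proof -
    \<comment> \<open>Equal weights for the upper pursuers balance the first coordinates; the ratio
      \<open>offset k\<close> to \<open>2 * k^2\<close> balances the heights
      \<open>- 2 * k^2\<close> and \<open>offset k\<close>.\<close>
    define d where "d = offset k + 2 * k\<^sup>2"
    have d: "d > 0" using o by (simp add: d_def add_pos_nonneg)
    show ?thesis
    proof (intro exI conjI)
      show "offset k / d > 0" using d o by simp
      show "k\<^sup>2 / d > 0" "k\<^sup>2 / d > 0" using d assms by simp_all
      show "offset k / d + k\<^sup>2 / d + k\<^sup>2 / d = 1" using d unfolding add_divide_distrib[symmetric] by (simp add: d_def)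
      show "(offset k / d) *\<^sub>R a + (k\<^sup>2 / d) *\<^sub>R b + (k\<^sup>2 / d) *\<^sub>R c = 0"
        using d by (simp add: pt_eq_iff a_def b_def c_def field_simps)
    qed
  qed
  moreover have "range (start k) = {a, b, c}"
    by (auto simp: a_def b_def c_def UNIV_3)
  ultimately show ?thesis by (auto simp: evader_inside_def)
qed

section \<open>The Voronoi triangle and the naming of its vertices\<close>

lemma voronoi_start:
  assumes "0 < k" "k < 1"
  shows "voronoi_cell 0 (start k) =
    {x. - k\<^sup>2 < x $ 2 \<and> x $ 2 - k * x $ 1 < k - k\<^sup>2 \<and> x $ 2 + k * x $ 1 < k - k\<^sup>2}"
proof -
  note o = offset_bounds[OF assms]
  have *: "dist x 0 < dist x p \<longleftrightarrow> x \<bullet> p < p \<bullet> p / 2" for x p :: plane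
  proof -
    have "dist x 0 < dist x p \<longleftrightarrow> x \<bullet> x < (x - p) \<bullet> (x - p)"
      by (simp add: dist_norm norm_eq_sqrt_inner)
    then show ?thesis by (simp add: inner_diff inner_commute) linarith
  qed
  note sq = start_inner_self[OF assms]
  have 1: "x \<bullet> start k 1 < start k 1 \<bullet> start k 1 / 2 \<longleftrightarrow> - k\<^sup>2 < x $ 2" for x
  proof -
    have "x \<bullet> start k 1 < start k 1 \<bullet> start k 1 / 2 \<longleftrightarrow> 2 * k\<^sup>2 * (- x $ 2) < 2 * k\<^sup>2 * k\<^sup>2"
      by (simp add: inner_plane algebra_simps)
    also have "\<dots> \<longleftrightarrow> - x $ 2 < k\<^sup>2"
      using assms by (subst mult_less_cancel_left_pos) auto
    finally show ?thesis by auto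
  qed
  have 2: "x \<bullet> start k 2 < start k 2 \<bullet> start k 2 / 2 \<longleftrightarrow> x $ 2 - k * x $ 1 < k - k\<^sup>2" for x
  proof -
    have "x \<bullet> start k 2 = offset k * (x $ 2 - k * x $ 1)"
      by (simp add: inner_plane algebra_simps)
    then show ?thesis unfolding sq using o by simp
  qed
  have 3: "x \<bullet> start k 3 < start k 3 \<bullet> start k 3 / 2 \<longleftrightarrow> x $ 2 + k * x $ 1 < k - k\<^sup>2" for x
  proof -
    have "x \<bullet> start k 3 = offset k * (x $ 2 + k * x $ 1)"
      by (simp add: inner_plane algebra_simps)
    then show ?thesis unfolding sq using o by simp
  qed
  show ?thesis unfolding voronoi_cell_def * forall_3 1 2 3 ..
qed

lemma closed_triangle:
  fixes k h :: real
  assumes "0 < k"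
  shows "convex hull {pt 1 (- h), pt (- 1) (- h), pt 0 (k - h)} =
    {x. - h \<le> x $ 2 \<and> x $ 2 - k * x $ 1 \<le> k - h \<and> x $ 2 + k * x $ 1 \<le> k - h}" (is "_ = ?T")
proof (intro set_eqI iffI)
  fix x assume "x \<in> convex hull {pt 1 (- h), pt (- 1) (- h), pt 0 (k - h)}"
  then obtain u v w where uvw: "0 \<le> u" "0 \<le> v" "0 \<le> w" "u + v + w = 1"
    and x: "x = u *\<^sub>R pt 1 (- h) + v *\<^sub>R pt (- 1) (- h) + w *\<^sub>R pt 0 (k - h)"
    unfolding convex_hull_3 by blast
  have "k * x $ 1 = k * u - k * v" by (simp add: x algebra_simps)
  moreover have "x $ 2 = k * w - (u + v + w) * h" by (simp add: x algebra_simps)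
  moreover have "0 \<le> k * u" "0 \<le> k * v" "0 \<le> k * w" using assms uvw by simp_all
  moreover have "k * u + k * v + k * w = k * (u + v + w)" by (simp add: algebra_simps)
  ultimately show "x \<in> ?T" unfolding uvw by simp
next
  fix x assume x: "x \<in> ?T"
  define w where "w = (x $ 2 + h) / k"
  have kw: "k * w = x $ 2 + h" using assms by (simp add: w_def)
  have "0 \<le> w" using x assms by (simp add: w_def)
  moreover have "k * (w - x $ 1) \<le> k * 1" "k * (w + x $ 1) \<le> k * 1"
    using x by (simp_all add: ring_distribs kw)
  then have "w - x $ 1 \<le> 1" "w + x $ 1 \<le> 1" using assms by simp_all
  moreover have "x = ((1 - w + x $ 1) / 2) *\<^sub>R pt 1 (- h) + ((1 - w - x $ 1) / 2) *\<^sub>R pt (- 1) (- h) + w *\<^sub>R pt 0 (k - h)"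
    using kw by (simp add: pt_eq_iff field_simps)
  ultimately show "x \<in> convex hull {pt 1 (- h), pt (- 1) (- h), pt 0 (k - h)}"
    unfolding convex_hull_3 by (intro CollectI exI conjI) (assumption | simp add: field_simps)+
qed

lemma closure_voronoi_start:
  assumes "0 < k" "k < 1"
  shows "closure (voronoi_cell 0 (start k)) =
    convex hull {pt 1 (- k\<^sup>2), pt (- 1) (- k\<^sup>2), pt 0 (k - k\<^sup>2)}"
proof
  have kk: "0 < k\<^sup>2" "k\<^sup>2 < k" using assms by (auto simp: power2_eq_square)
  have "closed (convex hull {pt 1 (- k\<^sup>2), pt (- 1) (- k\<^sup>2), pt 0 (k - k\<^sup>2)})"
    by (intro compact_imp_closed compact_convex_hull finite_imp_compact) simp
  then show "closure (voronoi_cell 0 (start k)) \<subseteq> convex hull {pt 1 (- k\<^sup>2), pt (- 1) (- k\<^sup>2), pt 0 (k - k\<^sup>2)}"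
    by (rule closure_minimal[rotated])
      (use assms in \<open>auto simp: voronoi_start closed_triangle\<close>)
  show "convex hull {pt 1 (- k\<^sup>2), pt (- 1) (- k\<^sup>2), pt 0 (k - k\<^sup>2)} \<subseteq> closure (voronoi_cell 0 (start k))"
  proof
    fix x assume "x \<in> convex hull {pt 1 (- k\<^sup>2), pt (- 1) (- k\<^sup>2), pt 0 (k - k\<^sup>2)}"
    then have x: "- k\<^sup>2 \<le> x $ 2" "x $ 2 - k * x $ 1 \<le> k - k\<^sup>2" "x $ 2 + k * x $ 1 \<le> k - k\<^sup>2"
      using assms by (auto simp: closed_triangle)
    \<comment> \<open>Contraction towards the evader at the origin makes all three inequalities
      strict, their right-hand sides being positive.\<close>
    define \<mu> :: "nat \<Rightarrow> real" where "\<mu> n = 1 - inverse (real (Suc n))" for n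
    have lt: "\<mu> n * a < c" if "a \<le> c" "0 < c" for a c n
    proof -
      have \<mu>: "0 \<le> \<mu> n" "\<mu> n < 1" by (auto simp: \<mu>_def inverse_le_1_iff)
      then have "\<mu> n * a \<le> \<mu> n * c" using that by (intro mult_left_mono)
      also have "\<dots> < c" using \<mu> that by simp
      finally show ?thesis .
    qed
    have "\<mu> n *\<^sub>R x \<in> voronoi_cell 0 (start k)" for n
    proof -
      have "\<mu> n * (- x $ 2) < k\<^sup>2" "\<mu> n * (x $ 2 - k * x $ 1) < k - k\<^sup>2" "\<mu> n * (x $ 2 + k * x $ 1) < k - k\<^sup>2"
        using x kk by (intro lt; simp)+
      then show ?thesis using assms by (simp add: voronoi_start algebra_simps)
    qed
    moreover have "(\<lambda>n. \<mu> n *\<^sub>R x) \<longlonglongrightarrow> (1 - 0) *\<^sub>R x"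
      unfolding \<mu>_def by (intro tendsto_intros LIMSEQ_inverse_real_of_nat)
    ultimately show "x \<in> closure (voronoi_cell 0 (start k))"
      unfolding closure_sequential by (intro exI[of _ "\<lambda>n. \<mu> n *\<^sub>R x"]) simp
  qed
qed

lemma extreme_points_triangle:
  fixes a b c :: plane
  assumes "\<not> collinear {a, b, c}"
  shows "{x. x extreme_point_of (convex hull {a, b, c})} = {a, b, c}"
proof -
  have "\<not> affine_dependent {a, b, c}" using assms by (auto simp: collinear_3_eq_affine_dependent)
  then show ?thesis by (auto simp: extreme_point_of_convex_hull_affine_independent)
qed

lemma triangle_not_collinear:
  assumes "0 < k"
  shows "\<not> collinear {pt 1 (- h), pt (- 1) (- h), pt 0 (k - h)}"
  using collinear_plane[of "pt 1 (- h)" "pt (- 1) (- h)" "pt 0 (k - h)"] assms by auto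

text \<open>Extreme points recover the vertex set from the hull. The base has length 2 and both legs
  are shorter and equal, which leaves two mirror-image namings, indexed by
  \<open>\<sigma>\<close>.\<close>

lemma voronoi_vertices_start:
  assumes "0 < k" "k < 1"
  shows "voronoi_vertices 0 (start k) V1 V2 V3 \<longleftrightarrow>
    (\<exists>\<sigma>\<in>{1, - 1}. V1 = pt \<sigma> (- k\<^sup>2) \<and> V2 = pt (- \<sigma>) (- k\<^sup>2) \<and> V3 = pt 0 (k - k\<^sup>2))"
    (is "?L \<longleftrightarrow> ?R")
proof -
  define A B C where "A = pt 1 (- k\<^sup>2)" and "B = pt (- 1) (- k\<^sup>2)" and "C = pt 0 (k - k\<^sup>2)"
  have nc: "\<not> collinear {A, B, C}" using triangle_not_collinear[OF assms(1)] by (simp add: A_def B_def C_def)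
  have cl: "closure (voronoi_cell 0 (start k)) = convex hull {A, B, C}"
    using closure_voronoi_start[OF assms] by (simp add: A_def B_def C_def)
  have ne: "A \<noteq> B" "A \<noteq> C" "B \<noteq> C" using assms by (auto simp: pt_eq_iff A_def B_def C_def)
  have AB: "dist A B = 2" by (simp add: dist_norm norm_plane A_def B_def)
  have AC: "dist A C = sqrt (1 + k\<^sup>2)" and BC: "dist B C = sqrt (1 + k\<^sup>2)"
    by (simp_all add: dist_norm norm_plane A_def B_def C_def)
  have "1 + k\<^sup>2 < 2\<^sup>2" using assms power_less_one_iff[of k 2] by simp
  then have lt: "sqrt (1 + k\<^sup>2) < 2" by (intro real_less_lsqrt) auto
  have R: "?R \<longleftrightarrow> (V1 = A \<and> V2 = B \<or> V1 = B \<and> V2 = A) \<and> V3 = C"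
    by (auto simp: A_def B_def C_def)
  show ?thesis
  proof
    assume ?L
    then have nc': "\<not> collinear {V1, V2, V3}" and "convex hull {V1, V2, V3} = convex hull {A, B, C}"
      and d: "dist V2 V3 \<le> dist V1 V3" "dist V1 V3 \<le> dist V1 V2"
      using cl by (auto simp: voronoi_vertices_def)
    then have eq: "{V1, V2, V3} = {A, B, C}"
      using extreme_points_triangle[OF nc] extreme_points_triangle[OF nc'] by simp
    have "V1 \<noteq> V2" "V1 \<noteq> V3" "V2 \<noteq> V3" using nc' by (auto simp: insert_commute)
    moreover have "V1 \<in> {A, B, C}" "V2 \<in> {A, B, C}" "V3 \<in> {A, B, C}"
      unfolding eq[symmetric] by auto
    ultimately show ?R unfolding R using d AB AC BC lt by (auto simp: dist_commute)
  next
    assume ?R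
    then have "{V1, V2, V3} = {A, B, C}" unfolding R by auto
    moreover have "dist V2 V3 \<le> dist V1 V3 \<and> dist V1 V3 \<le> dist V1 V2"
      using \<open>?R\<close> AB AC BC lt unfolding R by (auto simp: dist_commute)
    ultimately show ?L unfolding voronoi_vertices_def using nc cl by simp
  qed
qed

lemma M_D_start:
  assumes "0 < k" "k < 1"
  shows "M_D 0 (start k) = 2 * (1 - k) + k * sqrt (1 + k\<^sup>2)"
proof -
  \<comment> \<open>The level of the evader is \<open>k^2\<close> above the base of a triangle of
    height \<open>k\<close>, so it cuts each leg at the parameter \<open>u = k\<close>. Here
    \<open>\<tau>\<close> selects the leg and \<open>\<sigma>\<close> the naming.\<close>
  have cut: "closed_segment (pt \<tau> (- k\<^sup>2)) (pt 0 (k - k\<^sup>2)) \<inter> line_through 0 (pt \<sigma> (- k\<^sup>2) - pt (- \<sigma>) (- k\<^sup>2)) = {pt (\<tau> * (1 - k)) 0}"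
    if "\<sigma> \<in> {1, - 1}" "\<tau> \<in> {1, - 1}" for \<sigma> \<tau> :: real
  proof (intro set_eqI iffI)
    fix x assume "x \<in> closed_segment (pt \<tau> (- k\<^sup>2)) (pt 0 (k - k\<^sup>2)) \<inter> line_through 0 (pt \<sigma> (- k\<^sup>2) - pt (- \<sigma>) (- k\<^sup>2))"
    then obtain u \<alpha> where u: "x = (1 - u) *\<^sub>R pt \<tau> (- k\<^sup>2) + u *\<^sub>R pt 0 (k - k\<^sup>2)"
      and \<alpha>: "x = \<alpha> *\<^sub>R (pt \<sigma> (- k\<^sup>2) - pt (- \<sigma>) (- k\<^sup>2))"
      by (auto simp: closed_segment_def line_through_def)
    have "x $ 2 = 0" by (simp add: \<alpha>)
    moreover have "x $ 2 = k * (u - k)" by (simp add: u algebra_simps power2_eq_square)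
    ultimately have "u = k" using assms by simp
    then show "x \<in> {pt (\<tau> * (1 - k)) 0}" using \<open>x $ 2 = 0\<close> by (simp add: pt_eq_iff) (simp add: u)
  next
    fix x assume x: "x \<in> {pt (\<tau> * (1 - k)) 0}"
    then have "x = (1 - k) *\<^sub>R pt \<tau> (- k\<^sup>2) + k *\<^sub>R pt 0 (k - k\<^sup>2)"
      by (simp add: pt_eq_iff algebra_simps power2_eq_square)
    moreover have "x = (\<tau> * (1 - k) / (2 * \<sigma>)) *\<^sub>R (pt \<sigma> (- k\<^sup>2) - pt (- \<sigma>) (- k\<^sup>2))"
      using x that by (auto simp: pt_eq_iff)
    then have "x \<in> line_through 0 (pt \<sigma> (- k\<^sup>2) - pt (- \<sigma>) (- k\<^sup>2))"
      unfolding line_through_def by auto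
    ultimately show "x \<in> closed_segment (pt \<tau> (- k\<^sup>2)) (pt 0 (k - k\<^sup>2)) \<inter> line_through 0 (pt \<sigma> (- k\<^sup>2) - pt (- \<sigma>) (- k\<^sup>2))"
      using assms by (auto simp: closed_segment_def)
  qed
  have len: "norm (pt (- \<sigma> * (1 - k)) 0 - pt (\<sigma> * (1 - k)) 0) + norm (pt (\<sigma> * (1 - k)) 0 - pt \<sigma> (- k\<^sup>2)) =
      2 * (1 - k) + k * sqrt (1 + k\<^sup>2)" if "\<sigma> \<in> {1, - 1}" for \<sigma> :: real
  proof -
    have "(\<sigma> * (1 - k) - \<sigma>)\<^sup>2 + (k\<^sup>2)\<^sup>2 = k\<^sup>2 * (1 + k\<^sup>2)"
      using that by (auto simp: power2_eq_square algebra_simps)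
    moreover have "(- \<sigma> * (1 - k) - \<sigma> * (1 - k))\<^sup>2 = (2 * (1 - k))\<^sup>2"
      using that by (auto simp: power2_eq_square algebra_simps)
    ultimately show ?thesis using assms by (simp add: norm_plane real_sqrt_mult)
  qed
  \<comment> \<open>The definite description in \<open>M_D\<close> is well defined because both
    namings lead to the same \<open>l\<close>.\<close>
  let ?\<Phi> = "\<lambda>l. \<exists>V1 V2 V3 S Q. voronoi_vertices 0 (start k) V1 V2 V3 \<and>
     closed_segment V2 V3 \<inter> line_through 0 (V1 - V2) = {S} \<and>
     closed_segment V1 V3 \<inter> line_through 0 (V1 - V2) = {Q} \<and> l = norm (S - Q) + norm (Q - V1)"
  have "?\<Phi> l \<longleftrightarrow> l = 2 * (1 - k) + k * sqrt (1 + k\<^sup>2)" for l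
  proof
    assume "?\<Phi> l"
    then obtain V1 V2 V3 S Q where V: "voronoi_vertices 0 (start k) V1 V2 V3"
      and S: "closed_segment V2 V3 \<inter> line_through 0 (V1 - V2) = {S}"
      and Q: "closed_segment V1 V3 \<inter> line_through 0 (V1 - V2) = {Q}"
      and l: "l = norm (S - Q) + norm (Q - V1)" by blast
    obtain \<sigma> where \<sigma>: "\<sigma> \<in> {1, - 1}" "V1 = pt \<sigma> (- k\<^sup>2)" "V2 = pt (- \<sigma>) (- k\<^sup>2)" "V3 = pt 0 (k - k\<^sup>2)"
      using V unfolding voronoi_vertices_start[OF assms] by blast
    have "S = pt (- \<sigma> * (1 - k)) 0" "Q = pt (\<sigma> * (1 - k)) 0"
      using S Q cut[of \<sigma> "- \<sigma>"] cut[of \<sigma> \<sigma>] \<sigma> by auto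
    then show "l = 2 * (1 - k) + k * sqrt (1 + k\<^sup>2)" using l len \<sigma> by simp
  next
    assume l: "l = 2 * (1 - k) + k * sqrt (1 + k\<^sup>2)"
    have "voronoi_vertices 0 (start k) (pt 1 (- k\<^sup>2)) (pt (- 1) (- k\<^sup>2)) (pt 0 (k - k\<^sup>2))"
      unfolding voronoi_vertices_start[OF assms] by auto
    then show "?\<Phi> l"
      using cut[of 1 "- 1"] cut[of 1 1] len[of 1] l
      by (intro exI[of _ "pt 1 (- k\<^sup>2)"] exI[of _ "pt (- 1) (- k\<^sup>2)"] exI[of _ "pt 0 (k - k\<^sup>2)"]
          exI[of _ "pt (- 1 * (1 - k)) 0"] exI[of _ "pt (1 * (1 - k)) 0"]) simp
  qed
  then show ?thesis unfolding M_D_def by simp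
qed

section \<open>The decentralized strategy\<close>

lemma perp_decomposition:
  assumes "z \<noteq> 0" "v \<bullet> z = 0"
  shows "v = (v \<bullet> perp z / (z \<bullet> z)) *\<^sub>R perp z"
proof -
  have "z \<bullet> z \<noteq> 0" using assms by simp
  moreover have "v $ 1 * z $ 1 + v $ 2 * z $ 2 = 0" using assms(2) by (simp add: inner_plane)
  then have "v $ 1 * (z \<bullet> z) = (v \<bullet> perp z) * perp z $ 1" "v $ 2 * (z \<bullet> z) = (v \<bullet> perp z) * perp z $ 2"
    unfolding inner_plane perp_def vector_2 by algebra+
  ultimately show ?thesis by (simp add: pt_eq_iff field_simps)
qed

lemma perp_orthogonal [simp]: "perp z \<bullet> z = 0"
  by (simp add: inner_plane perp_def)

lemma D_strategy_eq:
  assumes e: "norm e = 1"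
  shows "D_strategy P E e i = e + approach (P i - E) e"
proof -
  define z where "z = P i - E"
  define C where "C = (1 / 2) *\<^sub>R (P i + E)"
  have Cz: "C = E + (1 / 2) *\<^sub>R z" unfolding C_def z_def vec_eq_iff by (simp add: field_simps)
  show ?thesis
  proof (cases "z \<bullet> e \<le> 0")
    case True
    then show ?thesis by (simp add: D_strategy_def approach_def Let_def z_def)
  next
    case False
    then have ze: "z \<bullet> e > 0" and z: "z \<noteq> 0" by auto
    \<comment> \<open>The distance from \<open>E\<close> to the bisector in the direction
      \<open>e\<close>. The point reached there is equidistant from \<open>P i\<close> and
      \<open>E\<close>, so the pursuer also has to travel \<open>\<beta>\<close>.\<close>
    define \<beta> where "\<beta> = z \<bullet> z / (2 * (z \<bullet> e))"
    have \<beta>: "\<beta> > 0" "\<beta> * (z \<bullet> e) = z \<bullet> z / 2" using ze z by (simp_all add: \<beta>_def)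
    have "(THE x. x \<in> line_through E e \<inter> line_through C (perp z)) = E + \<beta> *\<^sub>R e"
    proof (rule the_equality)
      define v where "v = \<beta> *\<^sub>R e - (1 / 2) *\<^sub>R z"
      have "v \<bullet> z = \<beta> * (z \<bullet> e) - z \<bullet> z / 2"
        by (simp add: v_def inner_diff_left inner_commute[of e z])
      then have "v \<bullet> z = 0" using \<beta> by simp
      from perp_decomposition[OF z this]
      have "E + \<beta> *\<^sub>R e = C + (v \<bullet> perp z / (z \<bullet> z)) *\<^sub>R perp z" by (simp add: Cz v_def)
      then show "E + \<beta> *\<^sub>R e \<in> line_through E e \<inter> line_through C (perp z)"
        unfolding line_through_def by blast
    next
      fix x assume "x \<in> line_through E e \<inter> line_through C (perp z)"
      then obtain s r where x: "x = E + s *\<^sub>R e" "x = C + r *\<^sub>R perp z"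
        unfolding line_through_def by blast
      then have "s *\<^sub>R e = (1 / 2) *\<^sub>R z + r *\<^sub>R perp z" by (simp add: Cz)
      then have "(s *\<^sub>R e) \<bullet> z = ((1 / 2) *\<^sub>R z + r *\<^sub>R perp z) \<bullet> z" by simp
      also have "\<dots> = z \<bullet> z / 2" by (simp add: inner_add_left)
      finally have "s * (z \<bullet> e) = z \<bullet> z / 2" by (simp add: inner_commute)
      then have "s * (z \<bullet> e) = \<beta> * (z \<bullet> e)" unfolding \<beta>(2) .
      then show "x = E + \<beta> *\<^sub>R e" using x ze by simp
    qed
    moreover have "norm (E + \<beta> *\<^sub>R e - P i) = \<beta>"
    proof -
      have "(\<beta> *\<^sub>R e - z) \<bullet> (\<beta> *\<^sub>R e - z) = \<beta> * \<beta> * (e \<bullet> e) - 2 * (\<beta> * (z \<bullet> e)) + z \<bullet> z"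
        by (simp add: inner_diff inner_commute algebra_simps)
      also have "\<dots> = \<beta>\<^sup>2" using e \<beta> by (simp add: power2_eq_square norm_eq_sqrt_inner)
      finally show ?thesis using \<beta> by (simp add: norm_eq_sqrt_inner z_def algebra_simps)
    qed
    ultimately have "D_strategy P E e i = (1 / \<beta>) *\<^sub>R (\<beta> *\<^sub>R e - z)"
      using ze by (simp add: D_strategy_def Let_def z_def C_def algebra_simps)
    also have "\<dots> = e - (1 / \<beta>) *\<^sub>R z" using \<beta> by (simp add: scaleR_diff_right)
    also have "1 / \<beta> = 2 * (z \<bullet> e) / (z \<bullet> z)" by (simp add: \<beta>_def)
    finally show ?thesis using ze by (simp add: approach_def z_def)
  qed
qed

section \<open>Plays, capture times and game lengths\<close>

lemma play_norm: "is_play \<sigma> E0 P0 e E P \<Longrightarrow> 0 \<le> t \<Longrightarrow> norm (e t) = 1"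
  by (simp add: is_play_def evader_control_def)

lemma has_integral_point:
  fixes f :: "real \<Rightarrow> 'a::euclidean_space"
  assumes "(f has_integral y) {a}"
  shows "y = 0"
  using assms has_integral_refl(2)[of f a] by (rule has_integral_unique)

lemma play_initial:
  assumes "is_play \<sigma> E0 P0 e E P"
  shows "E 0 = E0" "P 0 i = P0 i"
proof -
  have "(e has_integral (E 0 - E0)) {0..0}"
    "((\<lambda>s. \<sigma> (P s) (E s) (e s) i) has_integral (P 0 i - P0 i)) {0..0}"
    using assms by (auto simp: is_play_def)
  then have "E 0 - E0 = 0" "P 0 i - P0 i = 0" by (auto dest: has_integral_point)
  then show "E 0 = E0" "P 0 i = P0 i" by simp_all
qed

lemma play_primitive:
  assumes "is_play \<sigma> E0 P0 e E P"
  shows "primitive_on (\<lambda>s. \<sigma> (P s) (E s) (e s) i - e s) (\<lambda>t. P t i - E t) 0 b"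
  by (rule primitive_on_diff)
    (use assms play_initial[OF assms] in \<open>auto simp: is_play_def primitive_on_def\<close>)

text \<open>The control alone determines the path of the evader, so only the relative positions
  \<open>z i\<close> remain to be found. Their equations may be coupled through
  \<open>\<sigma>\<close>.\<close>

lemma is_playI:
  fixes E0 :: plane and e :: "real \<Rightarrow> plane"
  defines "E \<equiv> \<lambda>t. E0 + integral {0..t} e"
  assumes e: "evader_control e" and z0: "\<And>i. z i 0 = P0 i - E0"
    and z: "\<And>i b. primitive_on (\<lambda>s. \<sigma> (\<lambda>j. E s + z j s) (E s) (e s) i - e s) (z i) 0 b"
  shows "is_play \<sigma> E0 P0 e E (\<lambda>t i. E t + z i t)"
proof -
  have E: "primitive_on e E 0 b" for b
  proof -
    have "(e has_integral integral {0..t} e) {0..t}" if "0 \<le> t" for t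
      using e that by (simp add: evader_control_def has_integral_integral)
    then show ?thesis by (auto simp: primitive_on_def E_def)
  qed
  have "primitive_on (\<lambda>s. e s + (\<sigma> (\<lambda>j. E s + z j s) (E s) (e s) i - e s)) (\<lambda>t. E t + z i t) 0 b" for i b
    by (rule primitive_on_add[OF E z])
  then have P: "primitive_on (\<lambda>s. \<sigma> (\<lambda>j. E s + z j s) (E s) (e s) i) (\<lambda>t. E t + z i t) 0 b" for i b
    by simp
  have start: "E 0 = E0" "E 0 + z i 0 = P0 i" for i by (simp_all add: E_def z0)
  show ?thesis
    unfolding is_play_def
  proof (intro conjI allI impI e)
    fix t :: real assume t: "0 \<le> t"
    show "(e has_integral (E t - E0)) {0..t}"
      using primitive_onD[OF E t order_refl] unfolding start(1) .
    fix i
    show "((\<lambda>s. \<sigma> (\<lambda>j. E s + z j s) (E s) (e s) i) has_integral (E t + z i t - P0 i)) {0..t}"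
      using primitive_onD[OF P[where i = i] t order_refl] unfolding start(2) .
  qed
qed

lemma capture_time_leI:
  assumes "\<And>T. 0 \<le> T \<Longrightarrow> (\<And>t i. 0 \<le> t \<Longrightarrow> t \<le> T \<Longrightarrow> P t i \<noteq> E t) \<Longrightarrow> T \<le> M" and "0 \<le> M"
  shows "capture_time E P \<le> ereal M"
proof (rule ccontr)
  assume "\<not> capture_time E P \<le> ereal M"
  then obtain T where T: "ereal M < ereal T" "ereal T < capture_time E P"
    using ereal_dense2[of "ereal M" "capture_time E P"] by (auto simp: not_le)
  have "P t i \<noteq> E t" if "0 \<le> t" "t \<le> T" for t i
  proof
    assume "P t i = E t"
    then have "capture_time E P \<le> ereal t"
      unfolding capture_time_def using that by (intro INF_lower) auto
    then show False using T that by (metis ereal_less_eq(3) leD order_trans)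
  qed
  then have "T \<le> M" using assms T by simp
  then show False using T by simp
qed

lemma capture_time_geI:
  assumes "\<And>t i. 0 \<le> t \<Longrightarrow> t \<le> T \<Longrightarrow> P t i \<noteq> E t"
  shows "ereal T \<le> capture_time E P"
  unfolding capture_time_def
proof (rule INF_greatest)
  fix t assume "t \<in> {t. 0 \<le> t \<and> (\<exists>i. P t i = E t)}"
  then have "\<not> t \<le> T" using assms[of t] by auto
  then show "ereal T \<le> ereal t" by simp
qed

lemma game_length_leI:
  assumes "\<And>e E P. is_play \<sigma> E0 P0 e E P \<Longrightarrow> capture_time E P \<le> M"
  shows "game_length \<sigma> E0 P0 \<le> M"
  unfolding game_length_def by (rule SUP_least) (use assms in auto)

lemma game_length_geI:
  assumes "is_play \<sigma> E0 P0 e E P" "M \<le> capture_time E P"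
  shows "M \<le> game_length \<sigma> E0 P0"
proof -
  have "capture_time E P \<le> game_length \<sigma> E0 P0"
    unfolding game_length_def
    by (rule SUP_upper2[of "(e, E, P)"]) (use assms in auto)
  with assms show ?thesis by (rule_tac order_trans)
qed

text \<open>The decentralized law decouples into one \<open>approach\<close> equation for each
  pursuer.\<close>

lemma D_play_exists:
  assumes e: "evader_control e"
  obtains E P where "is_play D_strategy E0 P0 e E P"
    "\<And>i t. 0 \<le> t \<Longrightarrow>
      integral {0..t} (\<lambda>t. max 0 ((P0 i - E0) \<bullet> e t)) < (P0 i - E0) \<bullet> (P0 i - E0) / 2 \<Longrightarrow> P t i \<noteq> E t"
proof -
  define E where "E t = E0 + integral {0..t} e" for t
  have en: "\<And>t. 0 \<le> t \<Longrightarrow> e integrable_on {0..t}" "\<And>t. 0 \<le> t \<Longrightarrow> norm (e t) = 1"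
    using e by (auto simp: evader_control_def)
  define \<Phi> where "\<Phi> i z \<longleftrightarrow> z 0 = P0 i - E0 \<and> (\<forall>b. primitive_on (\<lambda>t. approach (z t) (e t)) z 0 b) \<and>
    (\<forall>t\<ge>0. integral {0..t} (\<lambda>t. max 0 ((P0 i - E0) \<bullet> e t)) < (P0 i - E0) \<bullet> (P0 i - E0) / 2 \<longrightarrow> z t \<noteq> 0)"
    for i and z :: "real \<Rightarrow> plane"
  have "\<exists>z. \<Phi> i z" for i
    unfolding \<Phi>_def by (rule approach_exists[OF en, where ?z0.0 = "P0 i - E0"]) blast+
  then obtain z where "\<And>i. \<Phi> i (z i)" by metis
  then have z: "\<And>i. z i 0 = P0 i - E0"
    "\<And>i b. primitive_on (\<lambda>t. approach (z i t) (e t)) (z i) 0 b"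
    "\<And>i t. 0 \<le> t \<Longrightarrow> integral {0..t} (\<lambda>t. max 0 ((P0 i - E0) \<bullet> e t)) < (P0 i - E0) \<bullet> (P0 i - E0) / 2 \<Longrightarrow> z i t \<noteq> 0"
    unfolding \<Phi>_def by blast+
  have play: "is_play D_strategy E0 P0 e E (\<lambda>t i. E t + z i t)"
    unfolding E_def
  proof (rule is_playI[OF e, where z = z])
    show "z i 0 = P0 i - E0" for i by (rule z(1))
    fix i b
    show "primitive_on (\<lambda>s. D_strategy (\<lambda>j. E0 + integral {0..s} e + z j s) (E0 + integral {0..s} e) (e s) i - e s) (z i) 0 b"
      by (rule primitive_on_cong[OF z(2)]) (simp_all add: D_strategy_eq en)
  qed
  show ?thesis
  proof (rule that[OF play])
    fix i t assume "0 \<le> t" "integral {0..t} (\<lambda>t. max 0 ((P0 i - E0) \<bullet> e t)) < (P0 i - E0) \<bullet> (P0 i - E0) / 2"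
    from z(3)[OF this] show "E t + z i t \<noteq> E t" by simp
  qed
qed

section \<open>Linear programming duality for the decentralized length\<close>

lemma norm_one_components:
  fixes u :: plane
  assumes "norm u = 1"
  shows "(u $ 1)\<^sup>2 + (u $ 2)\<^sup>2 = 1"
  using assms by (simp add: norm_plane)

text \<open>The weights are the dual solution of the linear program which maximizes the duration
  of the evader's motion subject to the resources \<open>|z\<^sub>i|\<^sup>2 / 2\<close> of the three pursuers.\<close>

lemma dual_feasible:
  fixes a b k :: real
  assumes ab: "a\<^sup>2 + b\<^sup>2 = 1" and k: "0 < k" "k \<le> 1"
  shows "1 \<le> max 0 (- a + b / k) + max 0 (a + b / k) + sqrt (1 + k\<^sup>2) / k * max 0 (- b)"
proof (cases "0 \<le> b")
  case True
  then have "b * k \<le> b * 1" using k by (intro mult_left_mono)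
  then have "b \<le> b / k" using k by (simp add: le_divide_eq)
  moreover have "1 \<le> \<bar>a\<bar> + b"
  proof -
    have "1 \<le> (\<bar>a\<bar> + b)\<^sup>2" using ab True by (simp add: power2_sum)
    then have "\<bar>1\<bar> \<le> \<bar>\<bar>a\<bar> + b\<bar>" unfolding abs_le_square_iff by simp
    then show ?thesis using True by simp
  qed
  ultimately show ?thesis using True by (auto simp: abs_if split: if_splits)
next
  case False
  define s where "s = sqrt (1 + k\<^sup>2)"
  define q where "q = - b / k"
  have q: "q > 0" "b = - k * q" using False k by (simp_all add: q_def divide_less_0_iff)
  have s: "s\<^sup>2 = 1 + k\<^sup>2" "1 \<le> s" by (simp_all add: s_def)
  have one: "a\<^sup>2 + k\<^sup>2 * q\<^sup>2 = 1" using ab q by (simp add: power_mult_distrib)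
  have "1 \<le> max 0 (\<bar>a\<bar> - q) + s * q"
  proof (cases "\<bar>a\<bar> \<le> q")
    case True
    then have "a\<^sup>2 \<le> q\<^sup>2" using q abs_le_square_iff[of a q] by simp
    then have "1 \<le> (s * q)\<^sup>2" using one s by (simp add: power_mult_distrib algebra_simps)
    then have "1 \<le> s * q" using q s abs_le_square_iff[of 1 "s * q"] by simp
    then show ?thesis by simp
  next
    case False
    \<comment> \<open>Replacing one factor \<open>\<bar>a\<bar>\<close> of the mixed term by
      \<open>q\<close> suffices, because
      \<open>2 * (s - 1) + (s - 1)^2 = s^2 - 1 = k^2\<close>.\<close>
    have "q * q * (2 * (s - 1)) \<le> \<bar>a\<bar> * q * (2 * (s - 1))"
      using False q s by (intro mult_right_mono) auto
    moreover have "(\<bar>a\<bar> + (s - 1) * q)\<^sup>2 = a\<^sup>2 + \<bar>a\<bar> * q * (2 * (s - 1)) + (s - 1)\<^sup>2 * q\<^sup>2"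
      by (simp add: power2_eq_square algebra_simps)
    moreover have "q * q * (2 * (s - 1)) + (s - 1)\<^sup>2 * q\<^sup>2 = k\<^sup>2 * q\<^sup>2"
      using s(1) by algebra
    ultimately have "1 \<le> (\<bar>a\<bar> + (s - 1) * q)\<^sup>2" using one by simp
    then have "1 \<le> \<bar>a\<bar> + (s - 1) * q"
      using q s abs_le_square_iff[of 1 "\<bar>a\<bar> + (s - 1) * q"] by (simp add: add_nonneg_nonneg)
    then show ?thesis using False by (simp add: algebra_simps)
  qed
  moreover have "max 0 (\<bar>a\<bar> - q) \<le> max 0 (- a - q) + max 0 (a - q)" by auto
  moreover have "b / k = - q" by (simp add: q_def)
  moreover have "s / k * max 0 (- b) = s * q" using False by (simp add: q_def)
  ultimately show ?thesis by (simp add: s_def)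
qed

lemma max_zero_scale: "0 \<le> c \<Longrightarrow> max 0 (c * x) = c * max 0 x" for c x :: real
  by (auto simp: max_def zero_le_mult_iff mult_le_0_iff)

lemma start_inner:
  assumes "0 < k"
  shows "start k 1 \<bullet> u = 2 * k\<^sup>2 * (- u $ 2)"
    "start k 2 \<bullet> u = k * offset k * (- u $ 1 + u $ 2 / k)"
    "start k 3 \<bullet> u = k * offset k * (u $ 1 + u $ 2 / k)"
  using assms by (simp_all add: inner_plane field_simps)

lemma D_capture_upper:
  assumes k: "0 < k" "k < 1" and play: "is_play D_strategy 0 (start k) e E P"
    and T: "0 \<le> T" and free: "\<And>t i. 0 \<le> t \<Longrightarrow> t \<le> T \<Longrightarrow> P t i \<noteq> E t"
  shows "T \<le> 2 * (1 - k) + k * sqrt (1 + k\<^sup>2)"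
proof -
  note o = offset_bounds[OF k]
  note init = play_initial[OF play]
  have ray: "\<exists>J. ((\<lambda>t. max 0 (start k i \<bullet> e t)) has_integral J) {0..T} \<and> J < start k i \<bullet> start k i / 2" for i
  proof -
    have "primitive_on (\<lambda>t. approach (P t i - E t) (e t)) (\<lambda>t. P t i - E t) 0 T"
      by (rule primitive_on_cong[OF play_primitive[OF play, of i T]])
        (simp_all add: D_strategy_eq play_norm[OF play])
    from approach_ray[OF this T] show ?thesis using free init by (auto simp: field_simps)
  qed
  define f where "f i t = max 0 (start k i \<bullet> e t)" for i t
  obtain J where J: "\<And>i. (f i has_integral J i) {0..T}" "\<And>i. J i < start k i \<bullet> start k i / 2"
    using ray unfolding f_def[abs_def] by metis
  define s where "s = sqrt (1 + k\<^sup>2)"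
  \<comment> \<open>The weights of \<open>dual_feasible\<close>, divided by the scale factors in
    \<open>start_inner\<close>.\<close>
  define c where "c = s / (2 * k ^ 3)"
  define d where "d = 1 / (k * offset k)"
  have s: "s > 0" by (simp add: s_def add_pos_nonneg)
  have cd: "c > 0" "d > 0" using k o s by (simp_all add: c_def d_def)
  have upper: "((\<lambda>t. c * f 1 t + d * f 2 t + d * f 3 t) has_integral (c * J 1 + d * J 2 + d * J 3)) {0..T}"
    by (intro has_integral_add has_integral_mult_right J)
  have const: "((\<lambda>t. 1) has_integral T) {0..T}"
    using has_integral_const_real[of "1::real" 0 T] T by simp
  have "1 \<le> c * f 1 t + d * f 2 t + d * f 3 t" if "t \<in> {0..T}" for t
  proof -
    have "norm (e t) = 1" using play_norm[OF play] that by simp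
    from dual_feasible[OF norm_one_components[OF this], of k]
    have "1 \<le> max 0 (- e t $ 1 + e t $ 2 / k) + max 0 (e t $ 1 + e t $ 2 / k) + s / k * max 0 (- e t $ 2)"
      using k by (simp add: s_def)
    moreover have "c * f 1 t = s / k * max 0 (- e t $ 2)"
      unfolding f_def start_inner[OF k(1)] using k
      by (subst max_zero_scale) (simp_all add: c_def power2_eq_square power3_eq_cube)
    moreover have "d * f 2 t = max 0 (- e t $ 1 + e t $ 2 / k)" "d * f 3 t = max 0 (e t $ 1 + e t $ 2 / k)"
      unfolding f_def start_inner[OF k(1)] using k o by (subst max_zero_scale; simp add: d_def)+
    ultimately show ?thesis by simp
  qed
  then have "T \<le> c * J 1 + d * J 2 + d * J 3" by (rule has_integral_le[OF const upper])
  also have "\<dots> \<le> c * (2 * k ^ 4) + d * (offset k * (k - k\<^sup>2)) + d * (offset k * (k - k\<^sup>2))"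
    using J(2)[of 1] J(2)[of 2] J(2)[of 3] cd unfolding start_inner_self[OF k]
    by (intro add_mono mult_left_mono) auto
  also have "c * (2 * k ^ 4) = k * s"
    using k by (simp add: c_def power3_eq_cube power4_eq_xxxx)
  also have "d * (offset k * (k - k\<^sup>2)) = 1 - k"
    using k o by (simp add: d_def field_simps power2_eq_square)
  finally show ?thesis by (simp add: s_def)
qed

lemma has_integral_const_interval:
  fixes c :: "'a::euclidean_space"
  assumes "a \<le> b" "\<And>t. a < t \<Longrightarrow> t \<le> b \<Longrightarrow> f t = c"
  shows "(f has_integral (b - a) *\<^sub>R c) {a..b}"
proof (rule has_integral_spike_finite[of "{a}" _ f "\<lambda>_. c"])
  show "((\<lambda>_. c) has_integral (b - a) *\<^sub>R c) {a..b}"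
    using has_integral_const_real[of c a b] assms by simp
qed (use assms in auto)

lemma has_integral_three_legs:
  fixes g :: "plane \<Rightarrow> 'a::euclidean_space"
  assumes "0 \<le> s" "0 \<le> c"
  shows "((\<lambda>t. g (if t \<le> s then u else if t \<le> 2 * s then v else w)) has_integral
    s *\<^sub>R g u + s *\<^sub>R g v + c *\<^sub>R g w) {0..2 * s + c}"
proof -
  let ?f = "\<lambda>t. g (if t \<le> s then u else if t \<le> 2 * s then v else w)"
  have "(?f has_integral (s - 0) *\<^sub>R g u) {0..s}" "(?f has_integral (2 * s - s) *\<^sub>R g v) {s..2 * s}"
    "(?f has_integral (2 * s + c - 2 * s) *\<^sub>R g w) {2 * s..2 * s + c}"
    using assms by (intro has_integral_const_interval; auto)+
  then show ?thesis
    using assms has_integral_combine[of 0 "2 * s" "2 * s + c" ?f, OF _ _ has_integral_combine[of 0 s "2 * s" ?f]]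
    by simp
qed

text \<open>The three legs use directions in which \<open>dual_feasible\<close> is an equality, and
  each leg spends the budget of a single pursuer: \<open>u\<close> that of 2, \<open>v\<close> that
  of 3, \<open>w\<close> that of 1. The factor \<open>\<mu> < 1\<close> leaves a remainder in every
  budget, which excludes capture.\<close>

lemma D_capture_lower:
  assumes k: "0 < k" "k < 1" and \<mu>: "0 < \<mu>" "\<mu> < 1"
  shows "ereal (\<mu> * (2 * (1 - k) + k * sqrt (1 + k\<^sup>2))) \<le> game_length D_strategy 0 (start k)"
proof -
  note o = offset_bounds[OF k]
  define s where "s = sqrt (1 + k\<^sup>2)"
  have s: "s > 0" "s * s = 1 + k\<^sup>2" by (simp_all add: s_def add_pos_nonneg)
  \<comment> \<open>The direction \<open>w\<close> is parallel to the right leg of the triangle,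
    hence orthogonal to \<open>start k 3\<close>.\<close>
  define u v w where "u = pt (- 1) 0" and "v = pt 1 0" and "w = pt (1 / s) (- k / s)"
  define r c where "r = \<mu> * (1 - k)" and "c = \<mu> * (k * s)"
  have rc: "0 \<le> r" "0 \<le> c" using k \<mu> s by (simp_all add: r_def c_def)
  define e where "e t = (if t \<le> r then u else if t \<le> 2 * r then v else w)" for t
  have legs: "((\<lambda>t. g (e t)) has_integral r *\<^sub>R g u + r *\<^sub>R g v + d *\<^sub>R g w) {0..2 * r + d}"
    if "0 \<le> d" for d and g :: "plane \<Rightarrow> 'a::euclidean_space"
    unfolding e_def using rc that by (intro has_integral_three_legs)
  have "(1 / s)\<^sup>2 + (- k / s)\<^sup>2 = (1 + k\<^sup>2) / (s * s)"
    by (simp add: power_divide power2_eq_square[of s] add_divide_distrib)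
  also have "\<dots> = 1" using s by (metis divide_self mult_pos_pos less_irrefl)
  finally have "(1 / s)\<^sup>2 + (- k / s)\<^sup>2 = 1" .
  then have "norm (e t) = 1" for t by (simp add: e_def u_def v_def w_def norm_plane)
  moreover have "e integrable_on {0..t}" if "t \<ge> 0" for t
    by (rule integrable_on_subinterval[of _ "{0..2 * r + t}"])
      (use legs[of t "\<lambda>x. x"] that rc in auto)
  ultimately have e: "evader_control e" by (simp add: evader_control_def)
  obtain E P where play: "is_play D_strategy 0 (start k) e E P"
    and free: "\<And>i t. 0 \<le> t \<Longrightarrow> integral {0..t} (\<lambda>t. max 0 ((start k i - 0) \<bullet> e t)) < (start k i - 0) \<bullet> (start k i - 0) / 2 \<Longrightarrow> P t i \<noteq> E t"
    using D_play_exists[OF e, of 0 "start k"] by metis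
  have "P t i \<noteq> E t" if "0 \<le> t" "t \<le> 2 * r + c" for t i
  proof (rule free[OF that(1)])
    have I: "((\<lambda>t. max 0 (start k i \<bullet> e t)) has_integral
        r * max 0 (start k i \<bullet> u) + r * max 0 (start k i \<bullet> v) + c * max 0 (start k i \<bullet> w)) {0..2 * r + c}"
      using legs[of c "\<lambda>x. max 0 (start k i \<bullet> x)"] rc by simp
    have "integral {0..t} (\<lambda>t. max 0 (start k i \<bullet> e t)) \<le> integral {0..2 * r + c} (\<lambda>t. max 0 (start k i \<bullet> e t))"
      by (rule integral_subset_le)
        (use I that in \<open>auto intro: integrable_on_subinterval[of _ "{0..2 * r + c}"]\<close>)
    also have "\<dots> = r * max 0 (start k i \<bullet> u) + r * max 0 (start k i \<bullet> v) + c * max 0 (start k i \<bullet> w)"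
      using I by (rule integral_unique)
    also have "\<dots> \<le> \<mu> * (start k i \<bullet> start k i / 2)"
    proof -
      have z1: "- (1 / s) + - k / s / k \<le> 0" and z2: "1 / s + - k / s / k = 0" using k s by simp_all
      consider "i = 1" | "i = 2" | "i = 3" using exhaust_3 by blast
      then show ?thesis
      proof cases
        case 1
        then show ?thesis unfolding 1 start_inner_self[OF k] unfolding start_inner[OF k(1)] using k s
          by (simp add: u_def v_def w_def c_def power2_eq_square power4_eq_xxxx)
      next
        case 2
        then show ?thesis unfolding 2 start_inner_self[OF k] unfolding start_inner[OF k(1)] using k s o(1) z1
          by (simp add: u_def v_def w_def r_def max_zero_scale power2_eq_square algebra_simps)
      next
        case 3
        then show ?thesis unfolding 3 start_inner_self[OF k] unfolding start_inner[OF k(1)] using k s o(1) z2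
          by (simp add: u_def v_def w_def r_def max_zero_scale power2_eq_square algebra_simps)
      qed
    qed
    also have "\<dots> < start k i \<bullet> start k i / 2"
    proof -
      have "start k i \<noteq> 0" using o k by (auto simp: start_def pt_eq_iff)
      then have "start k i \<bullet> start k i > 0" by simp
      then show ?thesis using \<mu> by simp
    qed
    finally show "integral {0..t} (\<lambda>t. max 0 ((start k i - 0) \<bullet> e t)) < (start k i - 0) \<bullet> (start k i - 0) / 2"
      by simp
  qed
  then have "ereal (2 * r + c) \<le> capture_time E P" by (rule capture_time_geI)
  from game_length_geI[OF play this] show ?thesis
    by (simp add: r_def c_def s_def algebra_simps)
qed

lemma game_length_D:
  assumes k: "0 < k" "k < 1"
  shows "game_length D_strategy 0 (start k) = ereal (2 * (1 - k) + k * sqrt (1 + k\<^sup>2))"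
    (is "?G = ereal ?M")
proof -
  have le: "?G \<le> ereal ?M"
  proof (intro game_length_leI capture_time_leI)
    fix e E P T assume "is_play D_strategy 0 (start k) e E P" "0 \<le> T"
      "\<And>t i. 0 \<le> t \<Longrightarrow> t \<le> T \<Longrightarrow> P t i \<noteq> E t"
    then show "T \<le> ?M" by (rule D_capture_upper[OF k])
  qed (use k in simp)
  have ge: "ereal (\<mu> * ?M) \<le> ?G" if "0 < \<mu>" "\<mu> < 1" for \<mu>
    by (rule D_capture_lower[OF k that])
  obtain g where g: "?G = ereal g" using le ge[of "1/2"] by (cases ?G) auto
  have "?M \<le> g" by (rule field_le_mult_one_interval) (use ge g in auto)
  then show ?thesis using le g by simp
qed

section \<open>A cooperative strategy\<close>

definition side :: "3 \<Rightarrow> real" where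
  "side i = (if i = 2 then - 1 else 1)"

text \<open>The threshold is the diagonal: a pursuer with relative position
  \<open>(\<plusminus>y, y)\<close> that follows the decentralized law has budget
  \<open>y^2\<close>, which allows the evader a horizontal run of length only \<open>y\<close>
  towards it.\<close>

definition flanking :: "(3 \<Rightarrow> plane) \<Rightarrow> plane \<Rightarrow> bool" where
  "flanking P E \<longleftrightarrow> (\<forall>i\<in>{2, 3}. side i * (P i - E) $ 1 < (P i - E) $ 2)"

text \<open>While both upper pursuers are still nearly above the evader, each of them gains height, and
  sideways distance whenever the evader runs to the other side; such a run therefore puts a
  pursuer behind the evader, which then cannot turn back.\<close>

definition cooperative :: pursuer_strategy where
  "cooperative P E e i =
     (if i \<noteq> 1 \<and> flanking P E then pt (side i * \<bar>e $ 1\<bar>) (- \<bar>e $ 2\<bar>) else D_strategy P E e i)"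

lemma side_cases: "side i \<in> {1, - 1}" "side i * side i = 1" "\<bar>side i\<bar> = 1"
  by (auto simp: side_def)

lemma norm_cooperative:
  assumes "norm e = 1"
  shows "norm (cooperative P E e i) = 1"
proof (cases "i \<noteq> 1 \<and> flanking P E")
  case True
  then show ?thesis using norm_one_components[OF assms] side_cases[of i]
    by (auto simp: cooperative_def norm_plane power_mult_distrib)
next
  case False
  then show ?thesis unfolding cooperative_def if_not_P[OF False]
    using assms by (simp add: D_strategy_eq norm_approach)
qed

section \<open>Closed-loop behaviour of the cooperative strategy\<close>

lemma approach_halfspace:
  assumes z: "primitive_on (\<lambda>t. approach (z t) (e t)) z a b"
    and "n \<bullet> z a \<le> 0" "a \<le> t" "t \<le> b"
  shows "n \<bullet> z t \<le> 0"
  using primitive_on_linear[OF z bounded_linear_inner_right[of n]]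
  by (rule primitive_on_nonpos) (use assms in \<open>auto simp: approach_def intro!: divide_nonneg_nonneg\<close>)

text \<open>Forward motion along \<open>n\<close>, with backward motion ignored. If \<open>n\<close>
  is the relative position of a pursuer at time \<open>a\<close>, this is the part of its budget
  that has been consumed.\<close>

definition advance :: "(real \<Rightarrow> plane) \<Rightarrow> plane \<Rightarrow> real \<Rightarrow> real \<Rightarrow> real" where
  "advance e n a t = integral {a..t} (\<lambda>s. max 0 (n \<bullet> e s))"

lemma advance_integral:
  assumes "evader_control e" "0 \<le> a"
  shows "((\<lambda>s. max 0 (n \<bullet> e s)) has_integral advance e n a t) {a..t}"
proof (cases "a \<le> t")
  case True
  then have "e integrable_on {a..t}"
    using assms by (intro integrable_on_subinterval[of e "{0..t}" a t]) (auto simp: evader_control_def)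
  then have "(\<lambda>s. max 0 (n \<bullet> e s)) integrable_on {a..t}"
    by (rule integrable_pos_part_inner) (use assms in \<open>auto simp: evader_control_def\<close>)
  then show ?thesis by (simp add: advance_def has_integral_integral)
qed (simp add: advance_def)

lemma advance_primitive:
  assumes "evader_control e" "0 \<le> a"
  shows "primitive_on (\<lambda>s. max 0 (n \<bullet> e s)) (advance e n a) a b"
  using advance_integral[OF assms] by (auto simp: primitive_on_def advance_def[of e n a a])

lemma advance_nonneg: "evader_control e \<Longrightarrow> 0 \<le> a \<Longrightarrow> 0 \<le> advance e n a t"
  by (rule has_integral_nonneg[OF advance_integral]) auto

text \<open>Since \<open>\<bar>e t $ 1\<bar> + \<bar>e t $ 2\<bar> \<ge> 1\<close> for unit vectors,
  it suffices later to bound the forward motion along the four axis directions.\<close>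

lemma duration_le:
  assumes e: "evader_control e" and a: "0 \<le> a" "a \<le> b" and \<sigma>: "\<sigma> \<in> {1, - 1}"
  shows "b - a \<le> advance e (pt \<sigma> 0) a b + advance e (pt (- \<sigma>) 0) a b + advance e (pt 0 1) a b + advance e (pt 0 (- 1)) a b"
proof (rule has_integral_le)
  show "((\<lambda>t. 1) has_integral (b - a)) {a..b}" using has_integral_const_real[of "1::real" a b] a by simp
  show "((\<lambda>t. max 0 (pt \<sigma> 0 \<bullet> e t) + max 0 (pt (- \<sigma>) 0 \<bullet> e t) + max 0 (pt 0 1 \<bullet> e t) + max 0 (pt 0 (- 1) \<bullet> e t)) has_integral
    advance e (pt \<sigma> 0) a b + advance e (pt (- \<sigma>) 0) a b + advance e (pt 0 1) a b + advance e (pt 0 (- 1)) a b) {a..b}"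
    by (intro has_integral_add advance_integral e a)
  fix t assume "t \<in> {a..b}"
  then have "norm (e t) = 1" using e a by (simp add: evader_control_def)
  then have "(e t $ 1)\<^sup>2 + (e t $ 2)\<^sup>2 = 1" by (rule norm_one_components)
  then have "1 \<le> (\<bar>e t $ 1\<bar> + \<bar>e t $ 2\<bar>)\<^sup>2" by (simp add: power2_sum)
  then have "\<bar>1\<bar> \<le> \<bar>\<bar>e t $ 1\<bar> + \<bar>e t $ 2\<bar>\<bar>" unfolding abs_le_square_iff by simp
  then show "1 \<le> max 0 (pt \<sigma> 0 \<bullet> e t) + max 0 (pt (- \<sigma>) 0 \<bullet> e t) + max 0 (pt 0 1 \<bullet> e t) + max 0 (pt 0 (- 1) \<bullet> e t)"
    using \<sigma> by (auto simp: inner_plane)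
qed

text \<open>The relative position in flanking mode in closed form. The factors 2 come from
  \<open>\<bar>a\<bar> - a = 2 * max 0 (- a)\<close> and
  \<open>- \<bar>a\<bar> - a = - 2 * max 0 a\<close>.\<close>

definition flank :: "real \<Rightarrow> (real \<Rightarrow> plane) \<Rightarrow> 3 \<Rightarrow> real \<Rightarrow> plane" where
  "flank k e i t = pt (side i * (k * offset k + 2 * advance e (pt (- side i) 0) 0 t))
     (offset k - 2 * advance e (pt 0 1) 0 t)"

lemma flank_start: "i \<noteq> 1 \<Longrightarrow> flank k e i 0 = start k i"
  using exhaust_3[of i] by (auto simp: flank_def advance_def side_def)

lemma flank_primitive:
  assumes e: "evader_control e"
  shows "primitive_on (\<lambda>t. pt (side i * \<bar>e t $ 1\<bar>) (- \<bar>e t $ 2\<bar>) - e t) (flank k e i) 0 b"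
proof -
  let ?g = "\<lambda>t. max 0 (pt (- side i) 0 \<bullet> e t) *\<^sub>R pt (2 * side i) 0 + max 0 (pt 0 1 \<bullet> e t) *\<^sub>R pt 0 (- 2)"
  let ?G = "\<lambda>t. advance e (pt (- side i) 0) 0 t *\<^sub>R pt (2 * side i) 0 + advance e (pt 0 1) 0 t *\<^sub>R pt 0 (- 2)"
  have P: "primitive_on ?g ?G 0 b"
    by (intro primitive_on_add primitive_on_linear[OF advance_primitive bounded_linear_scaleR_left] e) simp_all
  have g: "?g t = pt (side i * \<bar>e t $ 1\<bar>) (- \<bar>e t $ 2\<bar>) - e t" for t
    by (auto simp: pt_eq_iff inner_plane side_def)
  have G: "?G t - ?G 0 = flank k e i t - flank k e i 0" for t
    by (simp add: pt_eq_iff flank_def algebra_simps)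
  show ?thesis using P unfolding primitive_on_def G g .
qed

text \<open>The criterion involves only the control, so the switching time is known before a
  trajectory is constructed.\<close>

lemma flanking_flank:
  "(\<forall>i\<in>{2, 3}. side i * flank k e i t $ 1 < flank k e i t $ 2) \<longleftrightarrow>
    max (advance e (pt 1 0) 0 t) (advance e (pt (- 1) 0) 0 t) + advance e (pt 0 1) 0 t < (1 - k) * offset k / 2"
  by (auto simp: flank_def side_def field_simps)

text \<open>Chattering between the modes cannot occur: a pursuer that has reached the diagonal is
  afterwards only scaled towards \<open>0\<close> and so never flanks again. Hence
  \<open>flank\<close> up to the switch, continued by \<open>approach\<close> solutions, satisfies
  the feedback equation.\<close>

lemma cooperative_admissible:
  assumes k: "0 < k" "k < 1"
  shows "admissible_strategy 0 (start k) cooperative"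
  unfolding admissible_strategy_def
proof (intro conjI allI impI)
  fix P :: "3 \<Rightarrow> plane" and E e :: plane and i assume "norm e = 1"
  then show "norm (cooperative P E e i) = 1" by (rule norm_cooperative)
next
  fix e assume e: "evader_control e"
  have en: "\<And>t. 0 \<le> t \<Longrightarrow> e integrable_on {0..t}" "\<And>t. 0 \<le> t \<Longrightarrow> norm (e t) = 1"
    using e by (auto simp: evader_control_def)
  obtain z1 where z1: "z1 0 = start k 1" "\<And>b. primitive_on (\<lambda>t. approach (z1 t) (e t)) z1 0 b"
    by (rule approach_exists[OF en, where ?z0.0 = "start k 1"]) blast+
  let ?on = "\<lambda>z t. \<forall>i\<in>{2, 3}. side i * z i t $ 1 < z i t $ 2"
  \<comment> \<open>The mode depends on both upper pursuers, so their motions have to be constructed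
    together.\<close>
  have "\<exists>z :: 3 \<Rightarrow> real \<Rightarrow> plane. \<forall>i\<in>{2, 3}. z i 0 = start k i \<and>
    (\<forall>b. primitive_on (\<lambda>t. if ?on z t then pt (side i * \<bar>e t $ 1\<bar>) (- \<bar>e t $ 2\<bar>) - e t
       else approach (z i t) (e t)) (z i) 0 b)"
  proof -
    define h where "h t = max (advance e (pt 1 0) 0 t) (advance e (pt (- 1) 0) 0 t) + advance e (pt 0 1) 0 t - (1 - k) * offset k / 2" for t
    have on_flank: "?on (flank k e) t \<longleftrightarrow> h t < 0" for t
      unfolding flanking_flank h_def by simp
    have h0: "h 0 < 0" using offset_bounds[OF k] k by (simp add: h_def advance_def)
    show ?thesis
    proof (cases "\<exists>b\<ge>0. h b \<ge> 0")
      case False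
      then have on: "?on (flank k e) t" if "0 \<le> t" for t
        unfolding on_flank using that by (meson not_le)
      have "primitive_on (\<lambda>t. if ?on (flank k e) t then pt (side i * \<bar>e t $ 1\<bar>) (- \<bar>e t $ 2\<bar>) - e t
         else approach (flank k e i t) (e t)) (flank k e i) 0 b" for i b
        by (rule primitive_on_cong[OF flank_primitive[OF e]]) (rule refl, rule if_P[OF on, symmetric])
      then show ?thesis by (intro exI[of _ "flank k e"]) (auto simp: flank_start)
    next
      case True
      then obtain b where b: "0 \<le> b" "0 \<le> h b" by blast
      have "continuous_on {0..b} h"
        unfolding h_def
        by (intro continuous_intros primitive_on_continuous[OF advance_primitive[OF e]]) simp_all
      then obtain \<tau> where \<tau>: "0 \<le> \<tau>" "h \<tau> = 0" and before: "\<And>t. 0 \<le> t \<Longrightarrow> t < \<tau> \<Longrightarrow> h t < 0"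
        by (rule first_zero[OF _ h0 b(2,1)]) blast
      have en\<tau>: "\<And>t. \<tau> \<le> t \<Longrightarrow> e integrable_on {\<tau>..t}" "\<And>t. \<tau> \<le> t \<Longrightarrow> norm (e t) = 1"
      proof -
        fix t assume t: "\<tau> \<le> t"
        show "e integrable_on {\<tau>..t}"
          by (rule integrable_on_subinterval[of e "{0..t}"]) (use en t \<tau> in auto)
        show "norm (e t) = 1" using en t \<tau> by auto
      qed
      have "\<exists>v. v \<tau> = flank k e i \<tau> \<and> (\<forall>b. primitive_on (\<lambda>t. approach (v t) (e t)) v \<tau> b)" for i
        by (rule approach_exists[OF en\<tau>, where ?z0.0 = "flank k e i \<tau>"]) blast+
      then obtain v where v: "\<And>i. v i \<tau> = flank k e i \<tau>"
        "\<And>i b. primitive_on (\<lambda>t. approach (v i t) (e t)) (v i) \<tau> b" by metis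
      define z where "z i t = (if t < \<tau> then flank k e i t else v i t)" for i t
      obtain j where j: "j \<in> {2, 3}" "pt (- side j) 1 \<bullet> v j \<tau> \<le> 0"
        using on_flank[of \<tau>] \<tau> v by (auto simp: inner_plane not_less)
      have on: "?on z t" if "0 \<le> t" "t < \<tau>" for t
        using before[OF that] that(2) on_flank[of t] by (simp add: z_def)
      have off: "\<not> ?on z t" if "\<tau> \<le> t" for t
      proof -
        have "pt (- side j) 1 \<bullet> v j t \<le> 0" using approach_halfspace[OF v(2) j(2) that order_refl] .
        then have "\<not> side j * z j t $ 1 < z j t $ 2" using that by (simp add: z_def inner_plane)
        then show ?thesis using j by blast
      qed
      let ?g = "\<lambda>i t. if ?on z t then pt (side i * \<bar>e t $ 1\<bar>) (- \<bar>e t $ 2\<bar>) - e t else approach (z i t) (e t)"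
      have "primitive_on (?g i) (z i) 0 b" for i b
      proof (rule primitive_on_join)
        show "primitive_on (?g i) (z i) 0 \<tau>"
        proof (rule primitive_on_cong[OF flank_primitive[OF e, where i = i and k = k]])
          fix t :: real assume t: "0 \<le> t"
          show "flank k e i t = z i t" if "t \<le> \<tau>" using that v(1)[of i] by (auto simp: z_def)
          show "pt (side i * \<bar>e t $ 1\<bar>) (- \<bar>e t $ 2\<bar>) - e t = ?g i t" if "t < \<tau>"
            by (rule if_P[OF on[OF t that], symmetric])
        qed
        show "primitive_on (?g i) (z i) \<tau> b"
        proof (rule primitive_on_cong[OF v(2)[of i]])
          fix t assume t: "\<tau> \<le> t"
          then show z: "v i t = z i t" by (simp add: z_def)
          show "approach (v i t) (e t) = ?g i t"
            unfolding if_not_P[OF off[OF t]] z ..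
        qed
      qed (rule \<tau>)
      moreover have "z i 0 = start k i" if "i \<in> {2, 3}" for i
      proof -
        have "z i 0 = flank k e i 0" using \<tau> v(1)[of i] by (cases "\<tau> = 0") (auto simp: z_def)
        then show ?thesis using that by (auto simp: flank_start)
      qed
      ultimately show ?thesis by (intro exI[of _ z]) blast
    qed
  qed
  then obtain z where z0: "\<And>i. i \<in> {2, 3} \<Longrightarrow> z i 0 = start k i"
    and z: "\<And>i b. i \<in> {2, 3} \<Longrightarrow> primitive_on (\<lambda>t. if ?on z t then pt (side i * \<bar>e t $ 1\<bar>) (- \<bar>e t $ 2\<bar>) - e t
       else approach (z i t) (e t)) (z i) 0 b"
    by blast
  define y where "y i = (if i = 1 then z1 else z i)" for i
  have cases3: "i = 1 \<or> i \<in> {2, 3}" for i :: 3 using exhaust_3[of i] by blast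
  have ne: "(2::3) \<noteq> 1" "(3::3) \<noteq> 1" by simp_all
  have "is_play cooperative 0 (start k) e (\<lambda>t. 0 + integral {0..t} e) (\<lambda>t i. 0 + integral {0..t} e + y i t)"
  proof (rule is_playI[OF e, where z = y])
    show "y i 0 = start k i - 0" for i using z1 z0 cases3[of i] by (auto simp: y_def)
    fix i b
    let ?E = "\<lambda>t. 0 + integral {0..t} e"
    have fl: "flanking (\<lambda>j. ?E t + y j t) (?E t) \<longleftrightarrow> ?on z t" for t
      by (simp add: flanking_def y_def)
    show "primitive_on (\<lambda>s. cooperative (\<lambda>j. ?E s + y j s) (?E s) (e s) i - e s) (y i) 0 b"
    proof (cases "i = 1")
      case True
      show ?thesis unfolding True
        by (rule primitive_on_cong[OF z1(2)]) (simp_all add: y_def cooperative_def D_strategy_eq en)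
    next
      case False
      then have i: "i \<in> {2, 3}" using cases3 by blast
      show ?thesis
      proof (rule primitive_on_cong[OF z[OF i]])
        fix t :: real assume t: "0 \<le> t"
        show "z i t = y i t" using False by (simp add: y_def)
        show "(if ?on z t then pt (side i * \<bar>e t $ 1\<bar>) (- \<bar>e t $ 2\<bar>) - e t else approach (z i t) (e t)) =
          cooperative (\<lambda>j. ?E t + y j t) (?E t) (e t) i - e t"
          unfolding cooperative_def fl using False en(2)[OF t] by (simp add: D_strategy_eq y_def)
      qed
    qed
  qed
  then show "\<exists>E P. is_play cooperative 0 (start k) e E P" by blast
qed

text \<open>Each budget is split into axis-parallel motion. The pursuer behind restricts the way
  back to \<open>O(k)\<close>; the one ahead leaves the leading term \<open>y^2 / (2 * x)\<close>,
  which is at most 1 because \<open>y \<le> 2 * k\<close> and \<open>k * y \<le> x\<close>. In total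
  the duration is at most \<open>7 * y / 2 + 3 * k^2 + 1 + k\<close>, and
  \<open>7 + 3 + 1 = 11\<close>.\<close>

lemma final_phase:
  assumes e: "evader_control e" and \<tau>: "0 \<le> \<tau>" "\<tau> \<le> T" and k: "0 < k" "k < 1"
    and \<sigma>: "\<sigma> \<in> {1, - 1}" and y: "0 < y" "y \<le> 2 * k" and x: "k * y \<le> x" "x \<le> y"
    and behind: "advance e (pt (\<sigma> * y) y) \<tau> T \<le> y\<^sup>2"
    and ahead: "advance e (pt (- \<sigma> * x) y) \<tau> T \<le> (x\<^sup>2 + y\<^sup>2) / 2"
    and below: "advance e (pt 0 (- 1)) \<tau> T \<le> k\<^sup>2"
  shows "T - \<tau> \<le> 1 + 11 * k"
proof -
  define Ip Im Iu Id where "Ip = advance e (pt \<sigma> 0) \<tau> T" and "Im = advance e (pt (- \<sigma>) 0) \<tau> T"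
    and "Iu = advance e (pt 0 1) \<tau> T" and "Id = advance e (pt 0 (- 1)) \<tau> T"
  have x0: "0 < x" using x y k by (meson mult_pos_pos less_le_trans)
  have kk: "k\<^sup>2 \<le> k" using k by (simp add: power2_eq_square)
  have compare: "a * advance e m \<tau> T - b * advance e m' \<tau> T \<le> advance e n \<tau> T"
    if "\<And>u. a * max 0 (m \<bullet> u) - b * max 0 (m' \<bullet> u) \<le> max 0 (n \<bullet> u)" for a b m m' n
  proof (rule has_integral_le)
    show "((\<lambda>t. a * max 0 (m \<bullet> e t) - b * max 0 (m' \<bullet> e t)) has_integral
        a * advance e m \<tau> T - b * advance e m' \<tau> T) {\<tau>..T}"
      by (intro has_integral_diff has_integral_mult_right advance_integral e \<tau>)
    show "((\<lambda>t. max 0 (n \<bullet> e t)) has_integral advance e n \<tau> T) {\<tau>..T}"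
      by (rule advance_integral[OF e \<tau>(1)])
  qed (rule that)
  \<comment> \<open>Motion against the second component can hide at most
    \<open>b * max 0 (- q)\<close> of the progress in the first.\<close>
  have pos: "a * max 0 p - b * max 0 (- q) \<le> max 0 (a * p + b * q)" if "0 \<le> a" "0 \<le> b" for a b p q :: real
  proof -
    have "a * p \<le> a * max 0 p" "0 \<le> b * max 0 (- q)" "- (b * q) \<le> b * max 0 (- q)"
      using that mult_left_mono[of "- q" "max 0 (- q)" b] by (auto intro: mult_left_mono)
    then show ?thesis by (cases "0 \<le> p") (auto simp: max_def)
  qed
  have 1: "y * Ip - y * Id \<le> y\<^sup>2"
  proof -
    have "y * max 0 (pt \<sigma> 0 \<bullet> u) - y * max 0 (pt 0 (- 1) \<bullet> u) \<le> max 0 (pt (\<sigma> * y) y \<bullet> u)" for u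
      using pos[of y y "\<sigma> * u $ 1" "u $ 2"] y by (simp add: inner_plane algebra_simps)
    from order_trans[OF compare[OF this] behind] show ?thesis by (simp add: Ip_def Id_def)
  qed
  have 2: "x * Im - y * Id \<le> (x\<^sup>2 + y\<^sup>2) / 2"
  proof -
    have "x * max 0 (pt (- \<sigma>) 0 \<bullet> u) - y * max 0 (pt 0 (- 1) \<bullet> u) \<le> max 0 (pt (- \<sigma> * x) y \<bullet> u)" for u
      using pos[of x y "- \<sigma> * u $ 1" "u $ 2"] y x0 by (simp add: inner_plane algebra_simps)
    from order_trans[OF compare[OF this] ahead] show ?thesis by (simp add: Im_def Id_def)
  qed
  have 3: "y * Iu - x * Ip \<le> (x\<^sup>2 + y\<^sup>2) / 2"
  proof -
    have "y * max 0 (pt 0 1 \<bullet> u) - x * max 0 (pt \<sigma> 0 \<bullet> u) \<le> max 0 (pt (- \<sigma> * x) y \<bullet> u)" for u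
      using pos[of y x "u $ 2" "- \<sigma> * u $ 1"] y x0 by (simp add: inner_plane algebra_simps)
    from order_trans[OF compare[OF this] ahead] show ?thesis by (simp add: Iu_def Ip_def)
  qed
  have nn: "0 \<le> Ip" "0 \<le> Im" "0 \<le> Iu" "0 \<le> Id"
    using advance_nonneg[OF e \<tau>(1)] by (auto simp: Ip_def Im_def Iu_def Id_def)
  have Id: "Id \<le> k\<^sup>2" using below by (simp add: Id_def)
  have Ip: "Ip \<le> y + k\<^sup>2"
  proof -
    have "y * Ip \<le> y * (y + Id)" using 1 by (simp add: algebra_simps power2_eq_square)
    then show ?thesis using y Id by simp
  qed
  have Iu: "Iu \<le> y + Ip"
  proof -
    have "x\<^sup>2 \<le> y\<^sup>2" using x x0 by (intro power_mono) auto
    moreover have "x * Ip \<le> y * Ip" using x nn by (intro mult_right_mono)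
    ultimately have "y * Iu \<le> y * (y + Ip)" using 3 by (simp add: algebra_simps power2_eq_square)
    then show ?thesis using y by simp
  qed
  have Im: "Im \<le> x / 2 + 1 + k"
  proof -
    have "y * y \<le> 2 * k * y" using y by (intro mult_right_mono) auto
    also have "\<dots> \<le> 2 * x" using x by simp
    finally have "y\<^sup>2 / 2 \<le> x" by (simp add: power2_eq_square)
    moreover have "y * Id \<le> y * k\<^sup>2" using y Id by (intro mult_left_mono) auto
    moreover have "k * (k * y) \<le> k * x" using x k by (intro mult_left_mono) auto
    ultimately have "x * Im \<le> x * (x / 2 + 1 + k)" using 2 by (simp add: algebra_simps power2_eq_square)
    then show ?thesis using x0 by simp
  qed
  have "T - \<tau> \<le> Ip + Im + Iu + Id"
    using duration_le[OF e \<tau> \<sigma>] by (simp add: Ip_def Im_def Iu_def Id_def)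
  then show ?thesis using Id Ip Iu Im kk x y by linarith
qed

text \<open>The play is arbitrary, so the switch is recovered from its trajectory: flanking up to
  \<open>\<tau>\<close> forces the closed form \<open>flank\<close>, and flanking never returns
  later. The two phases contribute \<open>3 * k\<close> and \<open>1 + 11 * k\<close>.\<close>

lemma cooperative_capture:
  assumes k: "0 < k" "k < 1" and play: "is_play cooperative 0 (start k) e E P"
    and T: "0 \<le> T" and free: "\<And>t i. 0 \<le> t \<Longrightarrow> t \<le> T \<Longrightarrow> P t i \<noteq> E t"
  shows "T \<le> 1 + 14 * k"
proof -
  note o = offset_bounds[OF k]
  have e: "evader_control e" using play by (simp add: is_play_def)
  have kk: "k\<^sup>2 \<le> k" using k by (simp add: power2_eq_square)
  define z where "z i t = P t i - E t" for i t
  have z0: "z i 0 = start k i" for i using play_initial[OF play] by (simp add: z_def)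
  have nz: "z i t \<noteq> 0" if "0 \<le> t" "t \<le> T" for i t using free that by (simp add: z_def)
  define on where "on t \<longleftrightarrow> flanking (P t) (E t)" for t
  have on_iff: "on t \<longleftrightarrow> (\<forall>i\<in>{2, 3}. side i * z i t $ 1 < z i t $ 2)" for t
    by (simp add: on_def flanking_def z_def)
  have prim: "primitive_on (\<lambda>t. cooperative (P t) (E t) (e t) i - e t) (z i) 0 b" for i b
    unfolding z_def by (rule play_primitive[OF play])
  have drift: "cooperative (P t) (E t) (e t) i - e t =
      (if i \<noteq> 1 \<and> on t then pt (side i * \<bar>e t $ 1\<bar>) (- \<bar>e t $ 2\<bar>) - e t else approach (z i t) (e t))"
    if "0 \<le> t" for i t
    using play_norm[OF play that] by (simp add: cooperative_def on_def D_strategy_eq z_def)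
  \<comment> \<open>Available for pursuer 1 from the beginning, and for the upper pursuers from the
    switch on.\<close>
  have resource: "advance e (z i a) a T \<le> z i a \<bullet> z i a / 2"
    if "0 \<le> a" "a \<le> T" and off: "\<And>t. a \<le> t \<Longrightarrow> i = 1 \<or> \<not> on t" for i a
  proof -
    have "primitive_on (\<lambda>t. approach (z i t) (e t)) (z i) a T"
      by (rule primitive_on_cong[OF primitive_on_subinterval[OF prim[of i T] that(1) order_refl]])
        (use that drift[of _ i] in auto)
    from approach_ray[OF this that(2)] nz that(1)
    have "((\<lambda>t. max 0 (z i a \<bullet> e t)) has_integral (z i a \<bullet> z i a - z i a \<bullet> z i T) / 2) {a..T}"
      and "0 < z i a \<bullet> z i T" by auto
    then show ?thesis
      using has_integral_unique[OF advance_integral[OF e that(1)]] by fastforce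
  qed
  have below: "advance e (pt 0 (- 1)) a T \<le> k\<^sup>2" if "0 \<le> a" "a \<le> T" for a
  proof -
    have "advance e (start k 1) 0 T \<le> 2 * k ^ 4"
      using resource[of 0 1] T by (simp add: z0 start_inner_self[OF k, simplified])
    moreover have "advance e (start k 1) 0 T = 2 * k\<^sup>2 * advance e (pt 0 (- 1)) 0 T"
    proof -
      have "max 0 (start k 1 \<bullet> u) = 2 * k\<^sup>2 * max 0 (pt 0 (- 1) \<bullet> u)" for u
        unfolding start_inner[OF k(1)] by (subst max_zero_scale) (simp_all add: inner_plane)
      then show ?thesis unfolding advance_def by simp
    qed
    ultimately have "2 * k\<^sup>2 * advance e (pt 0 (- 1)) 0 T \<le> 2 * k\<^sup>2 * k\<^sup>2"
      by (simp add: power4_eq_xxxx power2_eq_square)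
    then have "advance e (pt 0 (- 1)) 0 T \<le> k\<^sup>2"
      using k mult_le_cancel_left_pos[of "2 * k\<^sup>2"] by fastforce
    moreover have "advance e (pt 0 (- 1)) a T \<le> advance e (pt 0 (- 1)) 0 T"
      by (rule has_integral_subset_le[OF _ advance_integral[OF e that(1)] advance_integral[OF e]])
        (use that in auto)
    ultimately show ?thesis by simp
  qed
  define g where "g i t = side i * z i t $ 1 - z i t $ 2" for i t
  define h where "h t = max (g 2 t) (g 3 t)" for t
  have on_h: "on t \<longleftrightarrow> h t < 0" for t by (simp add: on_iff h_def g_def)
  have cont: "continuous_on {0..T} h"
    unfolding h_def g_def by (intro continuous_intros primitive_on_continuous[OF prim])
  have h0: "h 0 < 0"
  proof -
    have "g i 0 = - (1 - k) * offset k" if "i \<in> {2, 3}" for i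
      using that by (auto simp: g_def z0 side_def algebra_simps)
    moreover have "- (1 - k) * offset k < 0" using o(1) k by (intro mult_neg_pos) auto
    ultimately show ?thesis unfolding h_def by simp
  qed
  \<comment> \<open>If flanking lasts throughout, \<open>\<tau> = T\<close> and the bound on the
    first phase alone is enough.\<close>
  obtain \<tau> where \<tau>: "0 \<le> \<tau>" "\<tau> \<le> T" "h \<tau> \<le> 0" and before: "\<And>t. 0 \<le> t \<Longrightarrow> t < \<tau> \<Longrightarrow> h t < 0"
    and alt: "\<tau> = T \<or> h \<tau> = 0"
  proof (cases "\<forall>t. 0 \<le> t \<and> t \<le> T \<longrightarrow> h t < 0")
    case True
    then show ?thesis using T by (intro that[of T]) (auto intro: less_imp_le)
  next
    case False
    then obtain b where b: "0 \<le> b" "b \<le> T" "0 \<le> h b" by (auto simp: not_less)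
    have "continuous_on {0..b} h" using b by (auto intro: continuous_on_subset[OF cont])
    then obtain \<rho> where "0 \<le> \<rho>" "\<rho> \<le> b" "h \<rho> = 0" "\<And>t. 0 \<le> t \<Longrightarrow> t < \<rho> \<Longrightarrow> h t < 0"
      by (rule first_zero[OF _ h0 b(3,1)]) blast
    then show ?thesis using b by (intro that[of \<rho>]) auto
  qed
  have flank: "z i \<tau> = flank k e i \<tau>" if "i \<in> {2, 3}" for i
  proof (rule primitive_on_unique)
    show "primitive_on (\<lambda>t. pt (side i * \<bar>e t $ 1\<bar>) (- \<bar>e t $ 2\<bar>) - e t) (z i) 0 \<tau>"
      by (rule primitive_on_cong[OF prim]) (use that before on_h drift in auto)
    show "primitive_on (\<lambda>t. pt (side i * \<bar>e t $ 1\<bar>) (- \<bar>e t $ 2\<bar>) - e t) (flank k e i) 0 \<tau>"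
      by (rule flank_primitive[OF e])
    show "z i 0 = flank k e i 0" using that by (auto simp: z0 flank_start)
  qed (use \<tau> in auto)
  define H U where "H i = advance e (pt (- side i) 0) 0 \<tau>" and "U = advance e (pt 0 1) 0 \<tau>" for i
  define x y where "x i = k * offset k + 2 * H i" and "y = offset k - 2 * U" for i
  have nn: "0 \<le> H i" "0 \<le> U" for i using advance_nonneg[OF e] by (auto simp: H_def U_def)
  have zx: "z i \<tau> = pt (side i * x i) y" if "i \<in> {2, 3}" for i
    using flank[OF that] by (simp add: flank_def H_def U_def x_def y_def)
  have gx: "g i \<tau> = x i - y" if "i \<in> {2, 3}" for i
    using zx[OF that] side_cases(2)[of i] by (simp add: g_def mult.assoc[symmetric])
  have xy: "x i \<le> y" if "i \<in> {2, 3}" for i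
    using \<tau>(3) gx that by (auto simp: h_def)
  have ypos: "0 < y" using xy[of 2] nn(1)[of 2] nn(2) o k by (simp add: x_def) (smt (verit) mult_pos_pos)
  have yle: "y \<le> offset k" using nn by (simp add: y_def)
  have first: "\<tau> \<le> 3 * k"
  proof -
    have "advance e (pt 0 (- 1)) 0 \<tau> \<le> advance e (pt 0 (- 1)) 0 T"
      by (rule has_integral_subset_le[OF _ advance_integral[OF e] advance_integral[OF e]])
        (use \<tau> in auto)
    then have "advance e (pt 0 (- 1)) 0 \<tau> \<le> k\<^sup>2" using below[of 0] T by simp
    moreover have "\<tau> - 0 \<le> H 2 + H 3 + U + advance e (pt 0 (- 1)) 0 \<tau>"
      using duration_le[OF e order_refl \<tau>(1), of 1] by (simp add: H_def U_def side_def)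
    \<comment> \<open>Added together, these give
      \<open>H 2 + H 3 + 2 * U \<le> offset k \<le> 2 * k\<close>; the third \<open>k\<close> pays
      for the descent.\<close>
    moreover have "2 * H 2 + 2 * U \<le> offset k" "2 * H 3 + 2 * U \<le> offset k"
      using xy[of 2] xy[of 3] o k by (auto simp: x_def y_def) (smt (verit) mult_pos_pos)+
    ultimately show ?thesis using o(2) kk nn(2) by linarith
  qed
  show ?thesis
  proof (cases "h \<tau> = 0")
    case False
    then show ?thesis using alt first k by simp
  next
    case True
    then obtain j where j: "j \<in> {2, 3}" "g j \<tau> = 0" by (auto simp: h_def max_def split: if_splits)
    define i :: 3 where "i = (if j = 2 then 3 else 2)"
    have i: "i \<in> {2, 3}" "side i = - side j" using j by (auto simp: i_def side_def)
    \<comment> \<open>Inside the diagonal, both modes drive pursuer \<open>j\<close> outwards or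
      leave it there, so it cannot re-enter, whatever the mode is at that moment.\<close>
    have stay: "- g j t \<le> 0" if t: "\<tau> \<le> t" for t
    proof -
      have "primitive_on (\<lambda>s. pt (- side j) 1 \<bullet> (cooperative (P s) (E s) (e s) j - e s)) (\<lambda>s. pt (- side j) 1 \<bullet> z j s) \<tau> t"
        by (rule primitive_on_linear[OF primitive_on_subinterval[OF prim \<tau>(1) order_refl] bounded_linear_inner_right])
      then have "pt (- side j) 1 \<bullet> z j t \<le> 0"
      proof (rule primitive_on_nonpos[OF _ _ t order_refl])
        show "pt (- side j) 1 \<bullet> z j \<tau> \<le> 0" using j by (simp add: inner_plane g_def)
        fix s assume s: "\<tau> \<le> s" "0 < pt (- side j) 1 \<bullet> z j s"
        show "pt (- side j) 1 \<bullet> (cooperative (P s) (E s) (e s) j - e s) \<le> 0"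
        proof (cases "on s")
          case True
          then show ?thesis using drift[of s j] s \<tau> j by (auto simp: inner_plane side_def)
        next
          case False
          then have "cooperative (P s) (E s) (e s) j - e s = approach (z j s) (e s)"
            using drift[of s j] s \<tau> by simp
          then show ?thesis using s by (simp add: approach_def divide_nonneg_nonneg)
        qed
      qed
      then show ?thesis by (simp add: inner_plane g_def)
    qed
    have off: "\<not> on t" if "\<tau> \<le> t" for t
      using stay[OF that] j unfolding on_iff g_def by force
    have sj: "side j * (side j * a) = a" for a
      using side_cases(2)[of j] by (simp add: mult.assoc[symmetric])
    have xj: "x j = y" using gx j by simp
    have "T - \<tau> \<le> 1 + 11 * k"
    proof (rule final_phase[OF e \<tau>(1,2) k side_cases(1) ypos, of "x i" j])
      show "y \<le> 2 * k" using yle o by simp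
      \<comment> \<open>Initially the ratio of sideways distance to height is \<open>k\<close>;
        during flanking the former never falls and the latter never rises.\<close>
      have "k * y \<le> k * offset k" using yle k by (intro mult_left_mono) auto
      then show "k * y \<le> x i" using nn(1)[of i] by (simp add: x_def)
      show "x i \<le> y" by (rule xy[OF i(1)])
      show "advance e (pt (side j * y) y) \<tau> T \<le> y\<^sup>2"
        using resource[OF \<tau>(1,2), of j] off unfolding zx[OF j(1)] xj
        by (simp add: inner_plane power2_eq_square algebra_simps sj side_cases(2))
      show "advance e (pt (- side j * x i) y) \<tau> T \<le> ((x i)\<^sup>2 + y\<^sup>2) / 2"
        using resource[OF \<tau>(1,2), of i] off unfolding zx[OF i(1)] i(2)
        by (simp add: inner_plane power2_eq_square algebra_simps sj side_cases(2))
      show "advance e (pt 0 (- 1)) \<tau> T \<le> k\<^sup>2" by (rule below[OF \<tau>(1,2)])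
    qed
    then show ?thesis using first by simp
  qed
qed

section \<open>The cooperative length\<close>

lemma M_C_upper:
  assumes k: "0 < k" "k < 1"
  shows "M_C 0 (start k) \<le> ereal (1 + 14 * k)"
proof -
  have "M_C 0 (start k) \<le> game_length cooperative 0 (start k)"
    unfolding M_C_def by (rule INF_lower) (simp add: cooperative_admissible[OF k])
  also have "\<dots> \<le> ereal (1 + 14 * k)"
  proof (intro game_length_leI capture_time_leI)
    fix e E P T assume "is_play cooperative 0 (start k) e E P" "0 \<le> T"
      "\<And>t i. 0 \<le> t \<Longrightarrow> t \<le> T \<Longrightarrow> P t i \<noteq> E t"
    then show "T \<le> 1 + 14 * k" by (rule cooperative_capture[OF k])
  qed (use k in simp)
  finally show ?thesis .
qed

text \<open>On a straight run to the right the evader stays in its initial Voronoi cell until time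
  \<open>1 - k\<close>. At every earlier time its position is strictly closer to its own start than
  to that of any pursuer, so no pursuer of unit speed can be there.\<close>

lemma M_C_lower:
  assumes k: "0 < k" "k < 1"
  shows "ereal (1 - k) \<le> M_C 0 (start k)"
  unfolding M_C_def
proof (rule INF_greatest)
  fix \<sigma> assume "\<sigma> \<in> {\<sigma>. admissible_strategy 0 (start k) \<sigma>}"
  then have adm: "admissible_strategy 0 (start k) \<sigma>" by simp
  note o = offset_bounds[OF k]
  define e :: "real \<Rightarrow> plane" where "e t = pt 1 0" for t
  have e: "evader_control e"
    by (simp add: evader_control_def e_def[abs_def] norm_plane integrable_const_ivl)
  obtain E P where play: "is_play \<sigma> 0 (start k) e E P"
    using adm e unfolding admissible_strategy_def by blast
  have away: "P t i \<noteq> E t" if t: "0 \<le> t" "t < 1 - k" for t i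
  proof
    assume hit: "P t i = E t"
    have straight: "(e has_integral t *\<^sub>R pt 1 0) {0..t}"
      unfolding e_def using has_integral_const_real[of "pt 1 0" 0 t] t by simp
    have "(e has_integral (E t - 0)) {0..t}" using play t by (simp add: is_play_def)
    from has_integral_unique[OF this straight] have Et: "E t = t *\<^sub>R pt 1 0" by simp
    have "((\<lambda>s. \<sigma> (P s) (E s) (e s) i) has_integral (P t i - start k i)) (cbox 0 t)"
      using play t by (simp add: is_play_def)
    then have "norm (P t i - start k i) \<le> 1 * measure lborel (cbox 0 t)"
    proof (rule has_integral_bound[rotated])
      fix s assume "s \<in> cbox 0 t"
      then have "norm (\<sigma> (P s) (E s) (e s) i) = 1"
        using adm play_norm[OF play, of s] unfolding admissible_strategy_def by simp
      then show "norm (\<sigma> (P s) (E s) (e s) i) \<le> 1" by simp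
    qed simp
    then have "norm (E t - start k i) \<le> t" using hit t by simp
    then have "(norm (E t - start k i))\<^sup>2 \<le> t\<^sup>2" by (intro power_mono) auto
    moreover have "(norm (E t - p))\<^sup>2 = E t \<bullet> E t - 2 * (E t \<bullet> p) + p \<bullet> p" for p
      by (simp add: power2_norm_eq_inner inner_diff_left inner_diff_right inner_commute)
    moreover have "E t \<bullet> E t = t\<^sup>2" by (simp add: Et inner_plane power2_eq_square)
    ultimately have "start k i \<bullet> start k i / 2 \<le> E t \<bullet> start k i" by simp
    moreover have "E t \<bullet> start k i < start k i \<bullet> start k i / 2"
    proof -
      consider "i = 1" | "i = 2" | "i = 3" using exhaust_3 by blast
      then show ?thesis
      proof cases
        case 1
        then show ?thesis using k by (simp add: Et inner_plane)
      next
        case 2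
        have "0 \<le> t * (k * offset k)" "0 < offset k * (k - k\<^sup>2)" 
          using t k o by (simp_all add: power2_eq_square)
        then show ?thesis unfolding 2 start_inner_self[OF k] by (simp add: Et inner_plane)
      next
        case 3
        have "t * (k * offset k) < (1 - k) * (k * offset k)"
          using t k o by (intro mult_strict_right_mono) auto
        then show ?thesis unfolding 3 start_inner_self[OF k]
          by (simp add: Et inner_plane power2_eq_square algebra_simps)
      qed
    qed
    ultimately show False by simp
  qed
  have "ereal s \<le> game_length \<sigma> 0 (start k)" if "s < 1 - k" for s
    by (rule game_length_geI[OF play capture_time_geI]) (use away that in auto)
  then show "ereal (1 - k) \<le> game_length \<sigma> 0 (start k)"
    by (metis (no_types, lifting) dense_le_bounded ereal_dense2 ereal_less(2) leD leI less_ereal.simps(1) linorder_not_le order_le_less_trans)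
qed

theorem theorem5:
  shows "\<exists>(E0 :: real \<Rightarrow> real ^ 2) (P0 :: real \<Rightarrow> 3 \<Rightarrow> real ^ 2) (m :: real).
    m > 0 \<and>
    (\<forall>\<delta>>0. evader_inside (E0 \<delta>) (P0 \<delta>) \<and>
       game_length D_strategy (E0 \<delta>) (P0 \<delta>) = ereal (M_D (E0 \<delta>) (P0 \<delta>))) \<and>
    ((\<lambda>\<delta>. M_D (E0 \<delta>) (P0 \<delta>)) \<longlongrightarrow> 2 * m) (at_right 0) \<and>
    ((\<lambda>\<delta>. M_C (E0 \<delta>) (P0 \<delta>)) \<longlongrightarrow> ereal m) (at_right 0)"
proof -
  \<comment> \<open>The claim concerns all \<open>\<delta> > 0\<close>, while the triangles require
    \<open>0 < k < 1\<close>; \<open>\<kappa>\<close> maps one range into the other and tends to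
    \<open>0\<close> with \<open>\<delta>\<close>.\<close>
  define \<kappa> :: "real \<Rightarrow> real" where "\<kappa> \<delta> = \<delta> / (1 + \<delta>)" for \<delta>
  have \<kappa>: "0 < \<kappa> \<delta>" "\<kappa> \<delta> < 1" if "0 < \<delta>" for \<delta>
    using that by (simp_all add: \<kappa>_def)
  have "(\<kappa> \<longlongrightarrow> 0 / (1 + 0)) (at_right 0)"
    unfolding \<kappa>_def by (intro tendsto_intros) simp
  then have lim: "(\<kappa> \<longlongrightarrow> 0) (at_right 0)" by simp
  have pos: "\<forall>\<^sub>F \<delta> in at_right 0. 0 < (\<delta>::real)" by (rule eventually_at_right_less)
  have "((\<lambda>\<delta>. 2 * (1 - \<kappa> \<delta>) + \<kappa> \<delta> * sqrt (1 + (\<kappa> \<delta>)\<^sup>2)) \<longlongrightarrow> 2 * (1 - 0) + 0 * sqrt (1 + 0\<^sup>2)) (at_right 0)"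
    by (intro tendsto_intros lim)
  moreover have "\<forall>\<^sub>F \<delta> in at_right 0. 2 * (1 - \<kappa> \<delta>) + \<kappa> \<delta> * sqrt (1 + (\<kappa> \<delta>)\<^sup>2) = M_D 0 (start (\<kappa> \<delta>))"
    using pos by (rule eventually_mono) (simp add: M_D_start \<kappa>)
  ultimately have "((\<lambda>\<delta>. M_D 0 (start (\<kappa> \<delta>))) \<longlongrightarrow> 2 * (1 - 0) + 0 * sqrt (1 + 0\<^sup>2)) (at_right 0)"
    by (rule Lim_transform_eventually)
  then have "((\<lambda>\<delta>. M_D 0 (start (\<kappa> \<delta>))) \<longlongrightarrow> 2 * 1) (at_right 0)" by simp
  moreover have "((\<lambda>\<delta>. M_C 0 (start (\<kappa> \<delta>))) \<longlongrightarrow> ereal 1) (at_right 0)"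
  proof (rule tendsto_sandwich)
    have "((\<lambda>\<delta>. 1 - \<kappa> \<delta>) \<longlongrightarrow> 1 - 0) (at_right 0)" "((\<lambda>\<delta>. 1 + 14 * \<kappa> \<delta>) \<longlongrightarrow> 1 + 14 * 0) (at_right 0)"
      by (intro tendsto_intros lim)+
    then show "((\<lambda>\<delta>. ereal (1 - \<kappa> \<delta>)) \<longlongrightarrow> ereal 1) (at_right 0)"
      "((\<lambda>\<delta>. ereal (1 + 14 * \<kappa> \<delta>)) \<longlongrightarrow> ereal 1) (at_right 0)" by simp_all
    show "\<forall>\<^sub>F \<delta> in at_right 0. ereal (1 - \<kappa> \<delta>) \<le> M_C 0 (start (\<kappa> \<delta>))"
      "\<forall>\<^sub>F \<delta> in at_right 0. M_C 0 (start (\<kappa> \<delta>)) \<le> ereal (1 + 14 * \<kappa> \<delta>)"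
      using pos by (auto elim!: eventually_mono intro: M_C_lower M_C_upper \<kappa>)
  qed
  moreover have "\<forall>\<delta>>0. evader_inside 0 (start (\<kappa> \<delta>)) \<and>
      game_length D_strategy 0 (start (\<kappa> \<delta>)) = ereal (M_D 0 (start (\<kappa> \<delta>)))"
    by (simp add: evader_inside_start game_length_D M_D_start \<kappa>)
  ultimately show ?thesis
    by (intro exI[of _ "\<lambda>_. 0"] exI[of _ "\<lambda>\<delta>. start (\<kappa> \<delta>)"] exI[of _ "1::real"]) simp
qed

end
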